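(* Let $M$ be a smooth manifold of dimension $n>2$, and let $(g,f)$ be an almost soliton pair on $M$, satisfying $\mathrm{r}+\nabla df=\lambda g$ with $\lambda$ a smooth function. Set $\tau=e^{\frac{2f}{n-2}}$. Then $(\widehat{g},\widehat{f}):=(g/\tau^2,-f)$ is also an almost soliton pair. It satisfies $\widehat{\mathrm{r}}+\widehat{\nabla}d\widehat{f}=\widehat{\lambda}\,\widehat{g}$ with $$\widehat{\lambda}=\tau^2(\lambda+\beta+\delta),$$ where $\beta=\tau^{-1}\Delta\tau-(n-1)\tau^{-2}|\nabla\tau|^2$ and $\delta=\tau^{-1}\tau'|\nabla f|^2$.
   Context: For a Riemannian metric $g$, $\mathrm{r}$ is its Ricci tensor, $\nabla df$ the $g$-Hessian of a smooth function $f$, $\nabla f$ the $g$-gradient, $|\cdot|$ the $g$-norm and $\Delta$ the Laplace operator of $g$ (trace of the Hessian). $\widehat{\mathrm{r}}$ and $\widehat\nabla d\widehat f$ are the Ricci tensor of $\widehat g$ and the $\widehat g$-Hessian of $\widehat f$. A pair $(g,f)$ is an almost soliton pair if $\mathrm{r}+\nabla df=\lambda g$ for some smooth function $\lambda:M\to\mathbb{R}$. The prime in $\tau'$ denotes differentiation of $\tau$, viewed as a function of $f$, with respect to $f$. *)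

theory Defs
  imports "HOL-Analysis.Analysis"
begin

section \<open>Smooth functions between normed spaces\<close>

text \<open>Class \<open>C^k\<close> on \<open>S\<close>, by recursion over all directional derivatives. Only used for open \<open>S\<close>.\<close>

primrec C_k_on :: "nat \<Rightarrow> 'a::real_normed_vector set \<Rightarrow> ('a \<Rightarrow> 'b::real_normed_vector) \<Rightarrow> bool" where
  "C_k_on 0 S f \<longleftrightarrow> continuous_on S f"
| "C_k_on (Suc k) S f \<longleftrightarrow>
     (\<forall>x\<in>S. f differentiable (at x)) \<and> (\<forall>v. C_k_on k S (\<lambda>x. frechet_derivative f (at x) v))"

definition smooth_on :: "'a::real_normed_vector set \<Rightarrow> ('a \<Rightarrow> 'b::real_normed_vector) \<Rightarrow> bool" where
  "smooth_on S f \<longleftrightarrow> (\<forall>k. C_k_on k S f)"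


section \<open>Smooth manifolds\<close>

text \<open>
  A chart is its domain together with its coordinate map; the values of the map outside the
  domain are irrelevant. The dimension of the manifold is the cardinality of the index type \<open>'n\<close>.
  A smooth structure is given by a smooth atlas, which need not be maximal.
\<close>

type_synonym ('a, 'n) chart = "'a set \<times> ('a \<Rightarrow> real ^ 'n)"

definition chart_inv :: "('a, 'n::finite) chart \<Rightarrow> real ^ 'n \<Rightarrow> 'a" where
  "chart_inv c = inv_into (fst c) (snd c)"

definition is_chart :: "'a topology \<Rightarrow> ('a, 'n::finite) chart \<Rightarrow> bool" where
  "is_chart X c \<longleftrightarrow> openin X (fst c) \<and> open (snd c ` fst c) \<and>
     homeomorphic_map (subtopology X (fst c)) (top_of_set (snd c ` fst c)) (snd c)"

definition transition :: "('a, 'n::finite) chart \<Rightarrow> ('a, 'n) chart \<Rightarrow> real ^ 'n \<Rightarrow> real ^ 'n" where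
  "transition c d = snd d \<circ> chart_inv c"

definition smooth_manifold :: "'a topology \<Rightarrow> ('a, 'n::finite) chart set \<Rightarrow> bool" where
  "smooth_manifold X A \<longleftrightarrow>
     Hausdorff_space X \<and> second_countable X \<and>
     (\<forall>c\<in>A. is_chart X c) \<and> (\<Union>c\<in>A. fst c) = topspace X \<and>
     (\<forall>c\<in>A. \<forall>d\<in>A. smooth_on (snd c ` (fst c \<inter> fst d)) (transition c d))"

definition smooth_function :: "('a, 'n::finite) chart set \<Rightarrow> ('a \<Rightarrow> real) \<Rightarrow> bool" where
  "smooth_function A h \<longleftrightarrow> (\<forall>c\<in>A. smooth_on (snd c ` fst c) (h \<circ> chart_inv c))"


section \<open>Tensor fields and Riemannian metrics\<close>

text \<open>
  A twice-covariant tensor field \<open>T\<close> is given by its component matrices: \<open>T c p $ i $ j\<close> is the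
  value of \<open>T\<close> at \<open>p\<close> on the coordinate vectors \<open>\<partial>_i\<close>, \<open>\<partial>_j\<close> of the chart \<open>c\<close>. Only the values
  for \<open>c\<close> in the atlas and \<open>p\<close> in the domain of \<open>c\<close> are relevant; the components in
  different charts are related by the transformation law.
\<close>

type_synonym ('a, 'n) tensor02 = "('a, 'n) chart \<Rightarrow> 'a \<Rightarrow> real ^ 'n ^ 'n"

definition smooth_tensor02 :: "('a, 'n::finite) chart set \<Rightarrow> ('a, 'n) tensor02 \<Rightarrow> bool" where
  "smooth_tensor02 A T \<longleftrightarrow>
     (\<forall>c\<in>A. smooth_on (snd c ` fst c) (T c \<circ> chart_inv c)) \<and>
     (\<forall>c\<in>A. \<forall>d\<in>A. \<forall>p \<in> fst c \<inter> fst d.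
        let J = jacobian (transition c d) (at (snd c p))
        in T c p = transpose J ** T d p ** J)"

definition riemannian_metric :: "('a, 'n::finite) chart set \<Rightarrow> ('a, 'n) tensor02 \<Rightarrow> bool" where
  "riemannian_metric A g \<longleftrightarrow> smooth_tensor02 A g \<and>
     (\<forall>c\<in>A. \<forall>p\<in>fst c. transpose (g c p) = g c p \<and> (\<forall>v. v \<noteq> 0 \<longrightarrow> v \<bullet> (g c p *v v) > 0))"


section \<open>Coordinate expressions\<close>

text \<open>
  Here \<open>G\<close> is the metric, as a matrix-valued function of the coordinates \<open>x\<close>, and \<open>h\<close> is a
  function of the coordinates.
\<close>

definition partial :: "'n::finite \<Rightarrow> (real ^ 'n \<Rightarrow> real) \<Rightarrow> real ^ 'n \<Rightarrow> real" where
  "partial i h x = frechet_derivative h (at x) (axis i 1)"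

text \<open>\<open>christoffel G k i j\<close> is \<open>\<Gamma>^k_{ij}\<close>, that is, \<open>\<nabla>_{\<partial>_i} \<partial>_j = \<Sum>k. \<Gamma>^k_{ij} \<partial>_k\<close>
  for the Levi-Civita connection.\<close>

definition christoffel ::
  "(real ^ 'n \<Rightarrow> real ^ 'n ^ 'n) \<Rightarrow> 'n::finite \<Rightarrow> 'n \<Rightarrow> 'n \<Rightarrow> real ^ 'n \<Rightarrow> real" where
  "christoffel G k i j x = (1/2) * (\<Sum>l\<in>UNIV. matrix_inv (G x) $ k $ l *
     (partial i (\<lambda>y. G y $ j $ l) x + partial j (\<lambda>y. G y $ i $ l) x - partial l (\<lambda>y. G y $ i $ j) x))"

text \<open>\<open>riemann G l k i j\<close> is the coefficient of \<open>\<partial>_l\<close> in \<open>R(\<partial>_i, \<partial>_j) \<partial>_k\<close>, where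
  \<open>R(\<partial>_i, \<partial>_j) = \<nabla>_{\<partial>_i} \<nabla>_{\<partial>_j} - \<nabla>_{\<partial>_j} \<nabla>_{\<partial>_i}\<close>; the Ricci tensor \<open>ricci_coord\<close> is
  \<open>Ric(\<partial>_j, \<partial>_k) = trace (V \<mapsto> R(V, \<partial>_j) \<partial>_k)\<close>, which is positive on round spheres.\<close>

definition riemann ::
  "(real ^ 'n \<Rightarrow> real ^ 'n ^ 'n) \<Rightarrow> 'n::finite \<Rightarrow> 'n \<Rightarrow> 'n \<Rightarrow> 'n \<Rightarrow> real ^ 'n \<Rightarrow> real" where
  "riemann G l k i j x =
     partial i (christoffel G l j k) x - partial j (christoffel G l i k) x +
     (\<Sum>m\<in>UNIV. christoffel G l i m x * christoffel G m j k x
                - christoffel G l j m x * christoffel G m i k x)"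

definition ricci_coord :: "(real ^ 'n \<Rightarrow> real ^ 'n ^ 'n) \<Rightarrow> real ^ 'n::finite \<Rightarrow> real ^ 'n ^ 'n" where
  "ricci_coord G x = (\<chi> j k. \<Sum>i\<in>UNIV. riemann G i k i j x)"

definition hessian_coord ::
  "(real ^ 'n \<Rightarrow> real ^ 'n ^ 'n) \<Rightarrow> (real ^ 'n \<Rightarrow> real) \<Rightarrow> real ^ 'n::finite \<Rightarrow> real ^ 'n ^ 'n" where
  "hessian_coord G h x =
     (\<chi> i j. partial i (partial j h) x - (\<Sum>k\<in>UNIV. christoffel G k i j x * partial k h x))"

definition gradient_coord ::
  "(real ^ 'n \<Rightarrow> real ^ 'n ^ 'n) \<Rightarrow> (real ^ 'n \<Rightarrow> real) \<Rightarrow> real ^ 'n::finite \<Rightarrow> real ^ 'n" where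
  "gradient_coord G h x = matrix_inv (G x) *v (\<chi> i. partial i h x)"


section \<open>Ricci tensor, Hessian, gradient and Laplacian on a manifold\<close>

definition ricci :: "('a, 'n::finite) tensor02 \<Rightarrow> ('a, 'n) tensor02" where
  "ricci g c p = ricci_coord (g c \<circ> chart_inv c) (snd c p)"

definition hessian :: "('a, 'n::finite) tensor02 \<Rightarrow> ('a \<Rightarrow> real) \<Rightarrow> ('a, 'n) tensor02" where
  "hessian g h c p = hessian_coord (g c \<circ> chart_inv c) (h \<circ> chart_inv c) (snd c p)"

text \<open>Vector fields, too, are given by their components in the charts.\<close>

definition gradient ::
  "('a, 'n::finite) tensor02 \<Rightarrow> ('a \<Rightarrow> real) \<Rightarrow> ('a, 'n) chart \<Rightarrow> 'a \<Rightarrow> real ^ 'n" where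
  "gradient g h c p = gradient_coord (g c \<circ> chart_inv c) (h \<circ> chart_inv c) (snd c p)"

text \<open>\<open>chart_value A F p\<close> is the common value of \<open>F c p\<close> over all charts \<open>c\<close> around \<open>p\<close>. It turns
  a scalar computed in coordinates in a chart-independent manner into a function on the manifold.\<close>

definition chart_value ::
  "('a, 'n::finite) chart set \<Rightarrow> (('a, 'n) chart \<Rightarrow> 'a \<Rightarrow> real) \<Rightarrow> 'a \<Rightarrow> real" where
  "chart_value A F p = (THE r. \<forall>c\<in>A. p \<in> fst c \<longrightarrow> F c p = r)"

definition laplacian ::
  "('a, 'n::finite) chart set \<Rightarrow> ('a, 'n) tensor02 \<Rightarrow> ('a \<Rightarrow> real) \<Rightarrow> 'a \<Rightarrow> real" where
  "laplacian A g h = chart_value A (\<lambda>c p. trace (matrix_inv (g c p) ** hessian g h c p))"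

definition metric_norm ::
  "('a, 'n::finite) chart set \<Rightarrow> ('a, 'n) tensor02 \<Rightarrow> (('a, 'n) chart \<Rightarrow> 'a \<Rightarrow> real ^ 'n) \<Rightarrow> 'a \<Rightarrow> real"
  where "metric_norm A g V = chart_value A (\<lambda>c p. sqrt (V c p \<bullet> (g c p *v V c p)))"


section \<open>Almost soliton pairs\<close>

definition almost_soliton_with ::
  "('a, 'n::finite) chart set \<Rightarrow> ('a, 'n) tensor02 \<Rightarrow> ('a \<Rightarrow> real) \<Rightarrow> ('a \<Rightarrow> real) \<Rightarrow> bool" where
  "almost_soliton_with A g f lam \<longleftrightarrow>
     riemannian_metric A g \<and> smooth_function A f \<and> smooth_function A lam \<and>
     (\<forall>c\<in>A. \<forall>p\<in>fst c. ricci g c p + hessian g f c p = lam p *\<^sub>R g c p)"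

definition almost_soliton_pair ::
  "('a, 'n::finite) chart set \<Rightarrow> ('a, 'n) tensor02 \<Rightarrow> ('a \<Rightarrow> real) \<Rightarrow> bool" where
  "almost_soliton_pair A g f \<longleftrightarrow> (\<exists>lam. almost_soliton_with A g f lam)"

end

theory Submission
  imports Defs
begin

text \<open>
  Put \<open>a = 2 / (n - 2)\<close> and \<open>\<phi> = - a f\<close>, so that the new metric is \<open>e\<^sup>2\<^sup>\<phi> g\<close>. The conformal
  change formulas are
  \<open>Ric' = Ric - (n - 2) (\<nabla>d\<phi> - d\<phi> \<otimes> d\<phi>) - (\<Delta>\<phi> + (n - 2) |d\<phi>|\<^sup>2) g\<close> and
  \<open>\<nabla>'dh = \<nabla>dh - d\<phi> \<otimes> dh - dh \<otimes> d\<phi> + g(\<nabla>\<phi>, \<nabla>h) g\<close>. For \<open>h = - f\<close> the terms in \<open>df \<otimes> df\<close> cancel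
  because \<open>(n - 2) a = 2\<close>, and \<open>Ric' + \<nabla>'dh = Ric + \<nabla>df + (a \<Delta>f - a |df|\<^sup>2) g\<close>, where
  \<open>a \<Delta>f - a |df|\<^sup>2 = \<beta> + \<delta>\<close>. The Laplacian and the norm of the gradient are functions on the
  manifold because the Hessian is a tensor, which rests on the transformation law of the
  Christoffel symbols.
\<close>

section \<open>Calculus of smooth functions\<close>

text \<open>The soliton equation is an identity of component matrices in each chart separately, so
  both conformal formulas are pure coordinate computations. What couples the charts is
  \<open>lamhat\<close>: the Laplacian and the norm in it are definite descriptions
  (\<open>chart_value\<close>), about whose values nothing follows until all charts around a point
  are known to agree. This agreement is also what makes \<open>lamhat\<close> smooth, since it then
  equals an explicit coordinate expression in every chart. The constant n - 1 in \<beta> comes from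
  \<tau> = e^(a f): the term Delta \<tau> / \<tau> contributes a^2 |df|^2, and a^2 - (n - 1) a^2 = -
  (n - 2) a^2 = - 2 a. Adding a |df|^2 from \<delta> leaves the coefficient - a. Smoothness is
  defined by recursion over Frechet derivatives, so every closure rule is an induction on the order,
  and it must hold for the inverse matrix too, because Christoffel symbols contain it.\<close>

lemma C_k_on_subset: "C_k_on k S f \<Longrightarrow> T \<subseteq> S \<Longrightarrow> C_k_on k T f"
  by (induction k arbitrary: f) (auto intro: continuous_on_subset)

lemma smooth_on_subset: "smooth_on S f \<Longrightarrow> T \<subseteq> S \<Longrightarrow> smooth_on T f"
  by (auto simp: smooth_on_def intro: C_k_on_subset)

text \<open>On an open set the derivative at a point depends only on nearby values, so equality on
  \<open>S\<close> passes to the Frechet derivatives and the induction goes through. Off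
  \<open>S\<close> the functions may differ.\<close>

lemma C_k_on_cong:
  assumes "open S" "\<And>x. x \<in> S \<Longrightarrow> f x = g x"
  shows "C_k_on k S f \<longleftrightarrow> C_k_on k S g"
proof -
  have imp: "C_k_on k S g" if "C_k_on k S f" "\<And>x. x \<in> S \<Longrightarrow> f x = g x"
    for k and f g :: "'a \<Rightarrow> 'b"
    using that
  proof (induction k arbitrary: f g)
    case 0
    then show ?case by (simp cong: continuous_on_cong)
  next
    case (Suc k)
    have d: "f differentiable (at x)" if "x \<in> S" for x
      using Suc.prems that by simp
    have "g differentiable (at x)" if "x \<in> S" for x
      using d[OF that] has_derivative_transform_within_open[of f _ x UNIV S g]
        \<open>open S\<close> that Suc.prems(2)
      unfolding differentiable_def by blast
    moreover have "C_k_on k S (\<lambda>x. frechet_derivative g (at x) v)" for v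
    proof (rule Suc.IH)
      show "C_k_on k S (\<lambda>x. frechet_derivative f (at x) v)" using Suc.prems(1) by simp
      show "frechet_derivative f (at x) v = frechet_derivative g (at x) v" if "x \<in> S" for x
        using frechet_derivative_transform_within_open[OF d[OF that] \<open>open S\<close> that Suc.prems(2)]
        by simp
    qed
    ultimately show ?case by simp
  qed
  show ?thesis using imp[of k f g] imp[of k g f] assms(2) by auto
qed

lemma C_k_on_Suc_imp: "C_k_on (Suc k) S f \<Longrightarrow> C_k_on k S f"
proof (induction k arbitrary: f)
  case 0
  then show ?case
    by (auto intro!: continuous_at_imp_continuous_on differentiable_imp_continuous_within)
next
  case (Suc k)
  have "C_k_on k S (\<lambda>x. frechet_derivative f (at x) v)" for v
    by (rule Suc.IH) (use Suc.prems in simp)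
  then show ?case using Suc.prems by simp
qed

text \<open>By uniqueness of the derivative, a closed formula \<open>f'\<close> may replace
  \<open>frechet_derivative\<close>. The closure rules below supply such a formula from the usual
  differentiation rules.\<close>

lemma C_k_on_SucI:
  assumes "open S" "\<And>x. x \<in> S \<Longrightarrow> (f has_derivative f' x) (at x)" "\<And>v. C_k_on k S (\<lambda>x. f' x v)"
  shows "C_k_on (Suc k) S f"
proof -
  have "C_k_on k S (\<lambda>x. frechet_derivative f (at x) v)" for v
    using assms(3)[of v] C_k_on_cong[OF assms(1), of "\<lambda>x. f' x v" "\<lambda>x. frechet_derivative f (at x) v"]
      frechet_derivative_at[OF assms(2)] by metis
  then show ?thesis using assms(2) by (auto simp: differentiable_def)
qed

lemma C_k_on_SucD:
  assumes "C_k_on (Suc k) S f" "x \<in> S"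
  shows "(f has_derivative frechet_derivative f (at x)) (at x)"
  using assms by (simp add: frechet_derivative_works)

lemma C_k_on_const: "C_k_on k S (\<lambda>x. c)"
proof (induction k arbitrary: c)
  case (Suc k)
  then show ?case by simp
qed simp

lemma C_k_on_bounded_linear:
  assumes "bounded_linear h" "open S" "C_k_on k S f"
  shows "C_k_on k S (\<lambda>x. h (f x))"
  using assms(3)
proof (induction k arbitrary: f)
  case 0
  then show ?case by (simp add: bounded_linear.continuous_on[OF assms(1)])
next
  case (Suc k)
  show ?case
  proof (rule C_k_on_SucI[OF assms(2)])
    show "((\<lambda>x. h (f x)) has_derivative (\<lambda>v. h (frechet_derivative f (at x) v))) (at x)"
      if "x \<in> S" for x
      using bounded_linear.has_derivative[OF assms(1)] C_k_on_SucD[OF Suc.prems that] by blast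
    show "C_k_on k S (\<lambda>x. h (frechet_derivative f (at x) v))" for v
      using Suc by simp
  qed
qed

lemma C_k_on_add:
  assumes "open S" "C_k_on k S f" "C_k_on k S g"
  shows "C_k_on k S (\<lambda>x. f x + g x)"
  using assms(2,3)
proof (induction k arbitrary: f g)
  case 0
  then show ?case by (simp add: continuous_on_add)
next
  case (Suc k)
  show ?case
  proof (rule C_k_on_SucI[OF assms(1)])
    show "((\<lambda>x. f x + g x) has_derivative
        (\<lambda>v. frechet_derivative f (at x) v + frechet_derivative g (at x) v)) (at x)"
      if "x \<in> S" for x
      by (intro has_derivative_add C_k_on_SucD[OF Suc.prems(1) that] C_k_on_SucD[OF Suc.prems(2) that])
    show "C_k_on k S (\<lambda>x. frechet_derivative f (at x) v + frechet_derivative g (at x) v)" for v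
      using Suc by simp
  qed
qed

text \<open>The product rule yields two terms of the same bilinear shape with one argument
  differentiated, hence the induction over arbitrary \<open>f\<close> and \<open>g\<close>. The
  undifferentiated argument is lowered by one order with \<open>C_k_on_Suc_imp\<close>. Products and
  scalar multiples are instances.\<close>

lemma C_k_on_bilinear:
  assumes B: "bounded_bilinear B" and "open S" "C_k_on k S f" "C_k_on k S g"
  shows "C_k_on k S (\<lambda>x. B (f x) (g x))"
  using assms(3,4)
proof (induction k arbitrary: f g)
  case 0
  then show ?case by (simp add: bounded_bilinear.continuous_on[OF B])
next
  case (Suc k)
  show ?case
  proof (rule C_k_on_SucI[OF assms(2)])
    show "((\<lambda>x. B (f x) (g x)) has_derivative
        (\<lambda>v. B (f x) (frechet_derivative g (at x) v) + B (frechet_derivative f (at x) v) (g x))) (at x)"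
      if "x \<in> S" for x
      by (intro bounded_bilinear.FDERIV[OF B] C_k_on_SucD[OF Suc.prems(1) that]
          C_k_on_SucD[OF Suc.prems(2) that])
    show "C_k_on k S (\<lambda>x. B (f x) (frechet_derivative g (at x) v)
        + B (frechet_derivative f (at x) v) (g x))" for v
      using Suc.prems
      by (intro C_k_on_add assms(2) Suc.IH C_k_on_Suc_imp[OF Suc.prems(1)] C_k_on_Suc_imp[OF Suc.prems(2)])
        auto
  qed
qed

text \<open>The derivative of 1/f is built from 1/f itself and the derivative of f, so the induction
  hypothesis applies to the same function one order lower. The exponential works alike.\<close>

lemma C_k_on_inverse:
  fixes f :: "'a::real_normed_vector \<Rightarrow> real"
  assumes "open S" "\<And>x. x \<in> S \<Longrightarrow> f x \<noteq> 0" "C_k_on k S f"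
  shows "C_k_on k S (\<lambda>x. inverse (f x))"
  using assms(3)
proof (induction k)
  case 0
  then show ?case using assms(2) by (simp add: continuous_on_inverse)
next
  case (Suc k)
  have f: "C_k_on k S f" using Suc.prems by (rule C_k_on_Suc_imp)
  show ?case
  proof (rule C_k_on_SucI[OF assms(1)])
    show "((\<lambda>x. inverse (f x)) has_derivative
        (\<lambda>v. - (inverse (f x) * frechet_derivative f (at x) v * inverse (f x)))) (at x)"
      if "x \<in> S" for x
      by (intro Deriv.has_derivative_inverse C_k_on_SucD[OF Suc.prems that] assms(2) that)
    show "C_k_on k S (\<lambda>x. - (inverse (f x) * frechet_derivative f (at x) v * inverse (f x)))" for v
      using Suc.prems
      by (intro C_k_on_bounded_linear[OF bounded_linear_minus[OF bounded_linear_ident]]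
            C_k_on_bilinear[OF bounded_bilinear_mult] assms(1) Suc.IH f) auto
  qed
qed

lemma C_k_on_exp:
  fixes f :: "'a::real_normed_vector \<Rightarrow> real"
  assumes "open S" "C_k_on k S f"
  shows "C_k_on k S (\<lambda>x. exp (f x))"
  using assms(2)
proof (induction k)
  case 0
  then show ?case by (simp add: continuous_on_exp)
next
  case (Suc k)
  have f: "C_k_on k S f" using Suc.prems by (rule C_k_on_Suc_imp)
  show ?case
  proof (rule C_k_on_SucI[OF assms(1)])
    show "((\<lambda>x. exp (f x)) has_derivative
        (\<lambda>v. exp (f x) * frechet_derivative f (at x) v)) (at x)"
      if "x \<in> S" for x
      using has_derivative_exp[OF C_k_on_SucD[OF Suc.prems that]] by (simp add: mult.commute)
    show "C_k_on k S (\<lambda>x. exp (f x) * frechet_derivative f (at x) v)" for v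
      using Suc.prems
      by (intro C_k_on_bilinear[OF bounded_bilinear_mult] assms(1) Suc.IH f) auto
  qed
qed

lemma smooth_on_cong:
  assumes "open S" "\<And>x. x \<in> S \<Longrightarrow> f x = g x"
  shows "smooth_on S f \<longleftrightarrow> smooth_on S g"
  unfolding smooth_on_def using C_k_on_cong[OF assms] by simp

lemma smooth_on_const [intro]: "smooth_on S (\<lambda>x. c)"
  by (simp add: smooth_on_def C_k_on_const)

lemma smooth_on_bounded_linear:
  "bounded_linear h \<Longrightarrow> open S \<Longrightarrow> smooth_on S f \<Longrightarrow> smooth_on S (\<lambda>x. h (f x))"
  by (simp add: smooth_on_def C_k_on_bounded_linear)

lemma smooth_on_add: "open S \<Longrightarrow> smooth_on S f \<Longrightarrow> smooth_on S g \<Longrightarrow> smooth_on S (\<lambda>x. f x + g x)"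
  by (simp add: smooth_on_def C_k_on_add)

lemma smooth_on_minus: "open S \<Longrightarrow> smooth_on S f \<Longrightarrow> smooth_on S (\<lambda>x. - f x)"
  by (rule smooth_on_bounded_linear[OF bounded_linear_minus[OF bounded_linear_ident]])

lemma smooth_on_diff: "open S \<Longrightarrow> smooth_on S f \<Longrightarrow> smooth_on S g \<Longrightarrow> smooth_on S (\<lambda>x. f x - g x)"
  using smooth_on_add[of S f "\<lambda>x. - g x"] smooth_on_minus[of S g] by simp

lemma smooth_on_mult:
  fixes f g :: "'a::real_normed_vector \<Rightarrow> real"
  shows "open S \<Longrightarrow> smooth_on S f \<Longrightarrow> smooth_on S g \<Longrightarrow> smooth_on S (\<lambda>x. f x * g x)"
  by (simp add: smooth_on_def C_k_on_bilinear[OF bounded_bilinear_mult])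

lemma smooth_on_scaleR:
  "open S \<Longrightarrow> smooth_on S f \<Longrightarrow> smooth_on S g \<Longrightarrow> smooth_on S (\<lambda>x. f x *\<^sub>R g x)"
  by (simp add: smooth_on_def C_k_on_bilinear[OF bounded_bilinear_scaleR])

lemma smooth_on_inverse:
  fixes f :: "'a::real_normed_vector \<Rightarrow> real"
  shows "open S \<Longrightarrow> (\<And>x. x \<in> S \<Longrightarrow> f x \<noteq> 0) \<Longrightarrow> smooth_on S f \<Longrightarrow> smooth_on S (\<lambda>x. inverse (f x))"
  by (simp add: smooth_on_def C_k_on_inverse)

lemma smooth_on_exp:
  fixes f :: "'a::real_normed_vector \<Rightarrow> real"
  shows "open S \<Longrightarrow> smooth_on S f \<Longrightarrow> smooth_on S (\<lambda>x. exp (f x))"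
  by (simp add: smooth_on_def C_k_on_exp)

lemma smooth_on_sum:
  "open S \<Longrightarrow> (\<And>i. i \<in> I \<Longrightarrow> smooth_on S (f i)) \<Longrightarrow> smooth_on S (\<lambda>x. \<Sum>i\<in>I. f i x)"
  by (induction I rule: infinite_finite_induct) (auto intro: smooth_on_add)

lemma smooth_on_prod:
  fixes f :: "'i \<Rightarrow> 'a::real_normed_vector \<Rightarrow> real"
  shows "open S \<Longrightarrow> (\<And>i. i \<in> I \<Longrightarrow> smooth_on S (f i)) \<Longrightarrow> smooth_on S (\<lambda>x. \<Prod>i\<in>I. f i x)"
  by (induction I rule: infinite_finite_induct) (auto intro: smooth_on_mult)

lemma smooth_on_vec_nth: "open S \<Longrightarrow> smooth_on S f \<Longrightarrow> smooth_on S (\<lambda>x. f x $ i)"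
  by (rule smooth_on_bounded_linear[OF bounded_linear_vec_nth])

lemma smooth_on_det:
  fixes M :: "'a::real_normed_vector \<Rightarrow> real ^ 'n ^ 'n"
  shows "open S \<Longrightarrow> (\<And>i j. smooth_on S (\<lambda>x. M x $ i $ j)) \<Longrightarrow> smooth_on S (\<lambda>x. det (M x))"
  unfolding det_def by (intro smooth_on_sum smooth_on_mult smooth_on_prod smooth_on_const)

section \<open>Cramer's rule and smooth dependence of the inverse matrix\<close>

lemma matrix_inv_works:
  fixes M :: "real ^ 'n ^ 'n"
  assumes "invertible M"
  shows "M ** matrix_inv M = mat 1" "matrix_inv M ** M = mat 1"
proof -
  have "M ** matrix_inv M = mat 1 \<and> matrix_inv M ** M = mat 1"
    using assms unfolding invertible_def matrix_inv_def by (rule someI_ex)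
  then show "M ** matrix_inv M = mat 1" "matrix_inv M ** M = mat 1" by auto
qed

text \<open>Column \<open>l\<close> of the inverse solves M v = e_l. Cramer's rule makes its entries
  determinants divided by \<open>det M\<close>, from which smoothness can be read off.\<close>

lemma matrix_inv_cramer:
  fixes M :: "real ^ 'n ^ 'n"
  assumes "invertible M"
  shows "matrix_inv M $ k $ l
      = det (\<chi> i j. if j = k then axis l 1 $ i else M $ i $ j) * inverse (det M)"
proof -
  have "M *v (matrix_inv M *v axis l 1) = axis l 1"
    by (simp add: matrix_vector_mul_assoc matrix_inv_works(1)[OF assms] del: matrix_vector_mult_basis)
  moreover have "det M \<noteq> 0" using assms by (simp add: invertible_det_nz)
  ultimately have "matrix_inv M *v axis l 1 =
      (\<chi> k. det (\<chi> i j. if j = k then axis l 1 $ i else M $ i $ j) / det M)"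
    by (rule cramer[THEN iffD1, rotated])
  then have "(matrix_inv M *v axis l 1) $ k =
      det (\<chi> i j. if j = k then axis l 1 $ i else M $ i $ j) / det M"
    by (simp del: matrix_vector_mult_basis)
  then show ?thesis by (simp add: matrix_vector_mult_basis column_def divide_inverse)
qed

lemma smooth_on_matrix_inv:
  fixes M :: "'a::real_normed_vector \<Rightarrow> real ^ 'n ^ 'n"
  assumes "open S" "\<And>x. x \<in> S \<Longrightarrow> invertible (M x)" "\<And>i j. smooth_on S (\<lambda>x. M x $ i $ j)"
  shows "smooth_on S (\<lambda>x. matrix_inv (M x) $ k $ l)"
proof -
  have "smooth_on S (\<lambda>x. (\<chi> i j. if j = k then axis l 1 $ i else M x $ i $ j) $ i $ j)" for i j
    by (cases "j = k") (auto simp: assms(3))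
  moreover have "smooth_on S (\<lambda>x. inverse (det (M x)))"
    using assms by (intro smooth_on_inverse smooth_on_det) (auto simp: invertible_det_nz)
  ultimately have "smooth_on S
      (\<lambda>x. det (\<chi> i j. if j = k then axis l 1 $ i else M x $ i $ j) * inverse (det (M x)))"
    by (intro smooth_on_mult smooth_on_det assms(1))
  then show ?thesis
    by (rule smooth_on_cong[OF assms(1), THEN iffD2, rotated]) (rule matrix_inv_cramer[OF assms(2)])
qed

section \<open>Derivatives of smooth functions and their symmetry\<close>

lemma smooth_on_differentiable: "smooth_on S f \<Longrightarrow> x \<in> S \<Longrightarrow> f differentiable (at x)"
  unfolding smooth_on_def using C_k_on.simps(2)[of 0] by blast

lemma smooth_on_frechet_derivative:
  "smooth_on S f \<Longrightarrow> smooth_on S (\<lambda>x. frechet_derivative f (at x) v)"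
  unfolding smooth_on_def using C_k_on.simps(2) by blast

lemma smooth_on_partial: "smooth_on S h \<Longrightarrow> smooth_on S (partial i h)"
  using smooth_on_frechet_derivative[of S h "axis i 1"] by (simp add: partial_def[abs_def])

text \<open>
  The second difference is symmetric in \<open>v\<close> and \<open>w\<close>, so that, letting \<open>s\<close> tend to zero, both mixed
  derivatives have the same limit.
\<close>

lemma mixed_difference_mean_value:
  fixes f :: "'a::real_normed_vector \<Rightarrow> real"
  assumes f: "\<And>z. z \<in> S \<Longrightarrow> f differentiable (at z)"
    and fv: "\<And>z. z \<in> S \<Longrightarrow> (\<lambda>y. frechet_derivative f (at y) v) differentiable (at z)"
    and S: "\<And>a b. 0 \<le> a \<Longrightarrow> a \<le> s \<Longrightarrow> 0 \<le> b \<Longrightarrow> b \<le> s \<Longrightarrow> x + a *\<^sub>R v + b *\<^sub>R w \<in> S"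
    and "s > 0"
  obtains a b where "0 \<le> a" "a \<le> s" "0 \<le> b" "b \<le> s"
    "f (x + s *\<^sub>R v + s *\<^sub>R w) - f (x + s *\<^sub>R v) - f (x + s *\<^sub>R w) + f x =
      s\<^sup>2 * frechet_derivative (\<lambda>y. frechet_derivative f (at y) v) (at (x + a *\<^sub>R v + b *\<^sub>R w)) w"
proof -
  let ?fv = "\<lambda>y. frechet_derivative f (at y) v"
  have lin: "frechet_derivative h (at z) (t *\<^sub>R u) = t * frechet_derivative h (at z) u"
    if "h differentiable (at z)" for h :: "'a \<Rightarrow> real" and z t u
    using linear_scale[OF linear_frechet_derivative[OF that]] by simp
  have F: "((\<lambda>t. f (x + t *\<^sub>R v + b *\<^sub>R w)) has_real_derivative ?fv (x + t *\<^sub>R v + b *\<^sub>R w)) (at t)"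
    if "0 \<le> t" "t \<le> s" "0 \<le> b" "b \<le> s" for t b
  proof -
    have d: "f differentiable (at (x + t *\<^sub>R v + b *\<^sub>R w))" using f S that by blast
    have "((\<lambda>t. x + t *\<^sub>R v + b *\<^sub>R w) has_derivative (\<lambda>h. h *\<^sub>R v)) (at t)"
      by (auto intro!: derivative_eq_intros)
    from has_derivative_compose[OF this d[unfolded frechet_derivative_works]]
    show ?thesis
      unfolding has_field_derivative_def by (simp add: lin[OF d] mult_commute_abs)
  qed
  \<comment> \<open>The second difference is the increment in \<open>t\<close> of f(x + t v + s w) -
    f(x + t v). One mean value step turns it into a difference of \<open>?fv\<close>, a second one
    along \<open>w\<close> into a mixed derivative.\<close>
  obtain a where a: "0 < a" "a < s"
    "(f (x + s *\<^sub>R v + s *\<^sub>R w) - f (x + s *\<^sub>R v)) - (f (x + 0 *\<^sub>R v + s *\<^sub>R w) - f (x + 0 *\<^sub>R v)) =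
      (s - 0) * (?fv (x + a *\<^sub>R v + s *\<^sub>R w) - ?fv (x + a *\<^sub>R v))"
  proof -
    have "\<exists>z>0. z < s \<and> (f (x + s *\<^sub>R v + s *\<^sub>R w) - f (x + s *\<^sub>R v))
        - (f (x + 0 *\<^sub>R v + s *\<^sub>R w) - f (x + 0 *\<^sub>R v)) =
      (s - 0) * (?fv (x + z *\<^sub>R v + s *\<^sub>R w) - ?fv (x + z *\<^sub>R v))"
      by (rule MVT2[OF \<open>s > 0\<close>, of "\<lambda>t. f (x + t *\<^sub>R v + s *\<^sub>R w) - f (x + t *\<^sub>R v)"])
        (use F[of _ s] F[of _ 0] \<open>s > 0\<close> in \<open>auto intro!: DERIV_diff\<close>)
    then show ?thesis using that by blast
  qed
  have G: "((\<lambda>t. ?fv (x + a *\<^sub>R v + t *\<^sub>R w)) has_real_derivative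
      frechet_derivative ?fv (at (x + a *\<^sub>R v + t *\<^sub>R w)) w) (at t)"
    if "0 \<le> t" "t \<le> s" for t
  proof -
    have d: "?fv differentiable (at (x + a *\<^sub>R v + t *\<^sub>R w))" using fv S a that by simp
    have "((\<lambda>t. x + a *\<^sub>R v + t *\<^sub>R w) has_derivative (\<lambda>h. h *\<^sub>R w)) (at t)"
      by (auto intro!: derivative_eq_intros)
    from has_derivative_compose[OF this d[unfolded frechet_derivative_works]]
    show ?thesis
      unfolding has_field_derivative_def by (simp add: lin[OF d] mult_commute_abs)
  qed
  obtain b where b: "0 < b" "b < s"
    "?fv (x + a *\<^sub>R v + s *\<^sub>R w) - ?fv (x + a *\<^sub>R v + 0 *\<^sub>R w) =
      (s - 0) * frechet_derivative ?fv (at (x + a *\<^sub>R v + b *\<^sub>R w)) w"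
    using MVT2[OF \<open>s > 0\<close> G] by blast
  show ?thesis
    by (rule that[of a b]) (use a b in \<open>auto simp: power2_eq_square\<close>)
qed

lemma symmetric_second_frechet_derivative:
  fixes f :: "'a::real_normed_vector \<Rightarrow> real"
  assumes "open S" "C_k_on 2 S f" "x \<in> S"
  shows "frechet_derivative (\<lambda>y. frechet_derivative f (at y) v) (at x) w =
    frechet_derivative (\<lambda>y. frechet_derivative f (at y) w) (at x) v"
proof -
  define D where "D v w y = frechet_derivative (\<lambda>y. frechet_derivative f (at y) v) (at y) w" for v w y
  have f: "f differentiable (at z)"
    and fv: "(\<lambda>y. frechet_derivative f (at y) v) differentiable (at z)" if "z \<in> S" for z v
    using assms(2) that by (auto simp: numeral_2_eq_2)
  have cont: "continuous_on S (D v w)" for v w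
    using assms(2) by (auto simp: numeral_2_eq_2 D_def[abs_def])
  have "dist (D v w x) (D w v x) \<le> e" if "e > 0" for e
  proof -
    obtain d where "d > 0" and d: "\<And>y. dist y x < d \<Longrightarrow> y \<in> S \<and> dist (D v w y) (D v w x) < e/2
        \<and> dist (D w v y) (D w v x) < e/2"
    proof -
      obtain d1 where "d1 > 0" "ball x d1 \<subseteq> S" using assms openE by blast
      moreover obtain d2 where "d2 > 0" "\<And>y. y \<in> S \<Longrightarrow> dist y x < d2 \<Longrightarrow> dist (D v w y) (D v w x) < e/2"
        using cont[of v w] assms(3) \<open>e > 0\<close> unfolding continuous_on_iff by (meson half_gt_zero)
      moreover obtain d3 where "d3 > 0" "\<And>y. y \<in> S \<Longrightarrow> dist y x < d3 \<Longrightarrow> dist (D w v y) (D w v x) < e/2"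
        using cont[of w v] assms(3) \<open>e > 0\<close> unfolding continuous_on_iff by (meson half_gt_zero)
      ultimately show ?thesis
        by (intro that[of "min d1 (min d2 d3)"]) (auto simp: dist_commute subset_iff)
    qed
    \<comment> \<open>Keeps the whole parallelogram spanned by \<open>s v\<close> and
      \<open>s w\<close> within d/2 of \<open>x\<close>; the summand 1 keeps the denominator
      positive when \<open>v\<close> and \<open>w\<close> both vanish.\<close>
    define s where "s = d / (2 * (norm v + norm w + 1))"
    have "s > 0" unfolding s_def using \<open>d > 0\<close>
      by (intro divide_pos_pos) (auto intro: add_nonneg_pos)
    have near: "dist (x + a *\<^sub>R v + b *\<^sub>R w) x < d" if "0 \<le> a" "a \<le> s" "0 \<le> b" "b \<le> s" for a b
    proof -
      have "dist (x + a *\<^sub>R v + b *\<^sub>R w) x \<le> a * norm v + b * norm w"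
        using norm_triangle_ineq[of "a *\<^sub>R v" "b *\<^sub>R w"] that by (simp add: dist_norm add.assoc)
      also have "\<dots> \<le> s * norm v + s * norm w"
        using that by (intro add_mono mult_right_mono) auto
      also have "\<dots> \<le> s * (norm v + norm w + 1)"
        using \<open>s > 0\<close> by (simp add: algebra_simps)
      also have "\<dots> = d / 2"
      proof -
        have "norm v + norm w + 1 \<noteq> 0" using add_nonneg_pos[of "norm v + norm w" 1] by simp
        then show ?thesis unfolding s_def by (simp del: distrib_left_numeral)
      qed
      finally show ?thesis using \<open>d > 0\<close> by simp
    qed
    have in_S: "x + a *\<^sub>R v + b *\<^sub>R w \<in> S" if "0 \<le> a" "a \<le> s" "0 \<le> b" "b \<le> s" for a b
      using near[OF that] d by blast
    let ?q = "f (x + s *\<^sub>R v + s *\<^sub>R w) - f (x + s *\<^sub>R v) - f (x + s *\<^sub>R w) + f x"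
    obtain a b where ab: "0 \<le> a" "a \<le> s" "0 \<le> b" "b \<le> s" "?q = s\<^sup>2 * D v w (x + a *\<^sub>R v + b *\<^sub>R w)"
      unfolding D_def
      by (rule mixed_difference_mean_value[OF f fv in_S \<open>s > 0\<close>]) auto
    have near': "x + a *\<^sub>R w + b *\<^sub>R v \<in> S" if "0 \<le> a" "a \<le> s" "0 \<le> b" "b \<le> s" for a b
      using near[of b a] d that by (simp add: add_ac)
    obtain a' b' where ab': "0 \<le> a'" "a' \<le> s" "0 \<le> b'" "b' \<le> s"
      "f (x + s *\<^sub>R w + s *\<^sub>R v) - f (x + s *\<^sub>R w) - f (x + s *\<^sub>R v) + f x =
        s\<^sup>2 * D w v (x + a' *\<^sub>R w + b' *\<^sub>R v)"
      unfolding D_def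
      by (rule mixed_difference_mean_value[OF f fv near' \<open>s > 0\<close>]) auto
    have swap: "x + s *\<^sub>R w + s *\<^sub>R v = x + s *\<^sub>R v + s *\<^sub>R w" by (simp add: add_ac)
    have "s\<^sup>2 * D v w (x + a *\<^sub>R v + b *\<^sub>R w) = s\<^sup>2 * D w v (x + a' *\<^sub>R w + b' *\<^sub>R v)"
      using ab(5) ab'(5) unfolding swap by linarith
    then have eq: "D v w (x + a *\<^sub>R v + b *\<^sub>R w) = D w v (x + b' *\<^sub>R v + a' *\<^sub>R w)"
      using \<open>s > 0\<close> by (simp add: add_ac)
    have "dist (D v w (x + a *\<^sub>R v + b *\<^sub>R w)) (D v w x) < e/2"
      "dist (D w v (x + b' *\<^sub>R v + a' *\<^sub>R w)) (D w v x) < e/2"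
      using d[OF near] ab ab' by auto
    then show ?thesis using eq by (metis dist_commute dist_triangle_half_r less_imp_le)
  qed
  then have "dist (D v w x) (D w v x) \<le> 0" by (rule field_le_epsilon) simp
  then show ?thesis by (simp add: D_def)
qed

lemma partial_commute:
  assumes "open S" "smooth_on S f" "x \<in> S"
  shows "partial i (partial j f) x = partial j (partial i f) x"
  using symmetric_second_frechet_derivative[OF assms(1) _ assms(3), of f] assms(2)
  by (simp add: partial_def[abs_def] smooth_on_def)

section \<open>Partial derivatives\<close>

text \<open>Allows rewriting under a derivative with identities that hold only on the coordinate
  domain.\<close>

lemma partial_cong:
  assumes "open U" "x \<in> U" "\<And>y. y \<in> U \<Longrightarrow> u y = v y"
  shows "partial i u x = partial i v x"
proof -
  have "(u has_derivative D) (at x) \<longleftrightarrow> (v has_derivative D) (at x)" for D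
    using has_derivative_transform_within_open[of u D x UNIV U v]
      has_derivative_transform_within_open[of v D x UNIV U u] assms by auto
  then show ?thesis by (simp add: partial_def frechet_derivative_def)
qed

lemma partial_const [simp]: "partial i (\<lambda>y. c) x = 0"
  by (simp add: partial_def)

lemma partial_eqI: "(u has_derivative D) (at x) \<Longrightarrow> partial i u x = D (axis i 1)"
  using frechet_derivative_at[of u D x] by (simp add: partial_def)

lemma partial_add:
  assumes "u differentiable (at x)" "v differentiable (at x)"
  shows "partial i (\<lambda>y. u y + v y) x = partial i u x + partial i v x"
  using partial_eqI[OF has_derivative_add[OF assms[unfolded frechet_derivative_works]]]
  by (simp add: partial_def)

lemma partial_diff:
  assumes "u differentiable (at x)" "v differentiable (at x)"
  shows "partial i (\<lambda>y. u y - v y) x = partial i u x - partial i v x"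
  using partial_eqI[OF has_derivative_diff[OF assms[unfolded frechet_derivative_works]]]
  by (simp add: partial_def)

lemma partial_mult:
  assumes "u differentiable (at x)" "v differentiable (at x)"
  shows "partial i (\<lambda>y. u y * v y) x = u x * partial i v x + partial i u x * v x"
  using partial_eqI[OF has_derivative_mult[OF assms[unfolded frechet_derivative_works]]]
  by (simp add: partial_def)

lemma partial_cmult:
  assumes "u differentiable (at x)"
  shows "partial i (\<lambda>y. c * u y) x = c * partial i u x"
  using partial_mult[of "\<lambda>_. c" x u i] assms by simp

lemma partial_sum:
  assumes "\<And>k. k \<in> I \<Longrightarrow> u k differentiable (at x)"
  shows "partial i (\<lambda>y. \<Sum>k\<in>I. u k y) x = (\<Sum>k\<in>I. partial i (u k) x)"
  using partial_eqI[OF has_derivative_sum[of I u "\<lambda>k. frechet_derivative (u k) (at x)" "at x"]] assms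
  by (simp add: partial_def frechet_derivative_works)

lemma partial_exp:
  assumes "u differentiable (at x)"
  shows "partial i (\<lambda>y. exp (u y)) x = exp (u x) * partial i u x"
  using partial_eqI[OF has_derivative_exp[OF assms[unfolded frechet_derivative_works]]]
  by (simp add: partial_def)

text \<open>The image of the basis vector under the derivative of \<psi> is column \<open>i\<close>
  of the Jacobian; expanding it in the standard basis gives the sum.\<close>

lemma partial_compose:
  fixes u :: "real ^ 'n::finite \<Rightarrow> real" and \<psi> :: "real ^ 'm::finite \<Rightarrow> real ^ 'n"
  assumes "\<psi> differentiable (at x)" "u differentiable (at (\<psi> x))"
  shows "partial i (\<lambda>y. u (\<psi> y)) x = (\<Sum>a\<in>UNIV. jacobian \<psi> (at x) $ a $ i * partial a u (\<psi> x))"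
proof -
  let ?w = "frechet_derivative \<psi> (at x) (axis i 1)"
  have "partial i (\<lambda>y. u (\<psi> y)) x = frechet_derivative u (at (\<psi> x)) ?w"
    using has_derivative_compose[OF assms[unfolded frechet_derivative_works]] by (rule partial_eqI)
  also have "?w = (\<Sum>a\<in>UNIV. (?w $ a) *s axis a 1)"
    by (simp add: basis_expansion)
  also have "frechet_derivative u (at (\<psi> x)) \<dots> = (\<Sum>a\<in>UNIV. ?w $ a * partial a u (\<psi> x))"
    using linear_frechet_derivative[OF assms(2)]
    by (simp add: linear_sum linear_scale partial_def scalar_mult_eq_scaleR)
  finally show ?thesis by (simp add: jacobian_def matrix_def)
qed

lemma partial_vec_nth:
  assumes "\<psi> differentiable (at x)"
  shows "partial i (\<lambda>y. \<psi> y $ a) x = jacobian \<psi> (at x) $ a $ i"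
  using partial_eqI[OF bounded_linear.has_derivative[OF bounded_linear_vec_nth
      assms[unfolded frechet_derivative_works]]]
  by (simp add: jacobian_def matrix_def)

section \<open>Metrics in coordinates\<close>

definition kron :: "'n \<Rightarrow> 'n \<Rightarrow> real" where
  "kron i j = (if i = j then 1 else 0)"

lemma kron_simps [simp]:
  "kron i i = 1"
  "(\<Sum>i\<in>UNIV. kron (i::'n::finite) j * F i) = F j"
  "(\<Sum>i\<in>UNIV. kron j (i::'n::finite) * F i) = F j"
  "(\<Sum>i\<in>UNIV. F i * kron (i::'n::finite) j) = F j"
  "(\<Sum>i\<in>UNIV. F i * kron j (i::'n::finite)) = F j"
  by (simp_all add: kron_def mult_delta_left mult_delta_right)

text \<open>A metric read in one chart, with \<open>U\<close> the open coordinate domain. Of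
  positive definiteness the coordinate formulas use its consequence
  \<open>invertible_G\<close>.\<close>

locale coord_metric =
  fixes U :: "(real ^ 'n::finite) set" and G :: "real ^ 'n \<Rightarrow> real ^ 'n ^ 'n"
  assumes open_U: "open U"
    and smooth_G: "smooth_on U (\<lambda>x. G x $ i $ j)"
    and sym_G: "x \<in> U \<Longrightarrow> G x $ i $ j = G x $ j $ i"
    and invertible_G: "x \<in> U \<Longrightarrow> invertible (G x)"
begin

abbreviation "Gi i j x \<equiv> matrix_inv (G x) $ i $ j"
abbreviation "\<Gamma> \<equiv> christoffel G"

lemma smooth_Gi: "smooth_on U (Gi i j)"
  by (rule smooth_on_matrix_inv[OF open_U invertible_G smooth_G])

lemmas smooth_intros = smooth_on_add smooth_on_diff smooth_on_mult smooth_on_sum smooth_on_const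
  smooth_on_partial smooth_on_minus open_U smooth_G smooth_Gi

lemma smooth_christoffel: "smooth_on U (\<Gamma> k i j)"
  unfolding christoffel_def[abs_def] by (intro smooth_intros)

lemma GGi: "x \<in> U \<Longrightarrow> (\<Sum>k\<in>UNIV. G x $ i $ k * Gi k j x) = kron i j"
  using matrix_inv_works(1)[OF invertible_G, of x]
  by (auto simp: matrix_matrix_mult_def vec_eq_iff mat_def kron_def)

lemma GiG: "x \<in> U \<Longrightarrow> (\<Sum>k\<in>UNIV. Gi i k x * G x $ k $ j) = kron i j"
  using matrix_inv_works(2)[OF invertible_G, of x]
  by (auto simp: matrix_matrix_mult_def vec_eq_iff mat_def kron_def)

lemma sym_Gi:
  assumes "x \<in> U"
  shows "Gi i j x = Gi j i x"
proof -
  have "Gi i j x = (\<Sum>k\<in>UNIV. Gi i k x * (\<Sum>l\<in>UNIV. Gi j l x * G x $ l $ k))"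
    by (simp add: GiG[OF assms])
  also have "\<dots> = (\<Sum>k\<in>UNIV. \<Sum>l\<in>UNIV. Gi i k x * G x $ k $ l * Gi j l x)"
    using sym_G[OF assms] by (simp add: sum_distrib_left mult_ac)
  also have "\<dots> = (\<Sum>l\<in>UNIV. (\<Sum>k\<in>UNIV. Gi i k x * G x $ k $ l) * Gi j l x)"
    by (subst sum.swap) (simp add: sum_distrib_right)
  also have "\<dots> = Gi j i x"
    by (simp add: GiG[OF assms])
  finally show ?thesis .
qed

lemma partial_sym_G: "x \<in> U \<Longrightarrow> partial k (\<lambda>y. G y $ i $ j) x = partial k (\<lambda>y. G y $ j $ i) x"
  by (rule partial_cong[OF open_U]) (auto intro: sym_G)

lemma christoffel_sym: "x \<in> U \<Longrightarrow> \<Gamma> k i j x = \<Gamma> k j i x"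
  unfolding christoffel_def using partial_sym_G[of x _ i j] by (simp add: add.commute)

text \<open>Lowering the upper index cancels the inverse matrix and leaves the symbols of the first
  kind. Most later computations with Christoffel symbols go through this form.\<close>

lemma christoffel_lower:
  assumes "x \<in> U"
  shows "(\<Sum>k\<in>UNIV. G x $ m $ k * \<Gamma> k i j x) =
    (1/2) * (partial i (\<lambda>y. G y $ j $ m) x + partial j (\<lambda>y. G y $ i $ m) x
        - partial m (\<lambda>y. G y $ i $ j) x)"
proof -
  let ?F = "\<lambda>l. partial i (\<lambda>y. G y $ j $ l) x + partial j (\<lambda>y. G y $ i $ l) x
      - partial l (\<lambda>y. G y $ i $ j) x"
  have "(\<Sum>k\<in>UNIV. G x $ m $ k * \<Gamma> k i j x)
      = (\<Sum>k\<in>UNIV. \<Sum>l\<in>UNIV. (1/2) * (G x $ m $ k * Gi k l x * ?F l))"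
    unfolding christoffel_def by (simp add: sum_distrib_left mult_ac)
  also have "\<dots> = (\<Sum>l\<in>UNIV. \<Sum>k\<in>UNIV. (1/2) * (G x $ m $ k * Gi k l x * ?F l))"
    by (rule sum.swap)
  also have "\<dots> = (1/2) * (\<Sum>l\<in>UNIV. (\<Sum>k\<in>UNIV. G x $ m $ k * Gi k l x) * ?F l)"
    by (simp only: sum_distrib_left sum_distrib_right)
  also have "\<dots> = (1/2) * ?F m"
    by (simp only: GGi[OF assms] kron_simps)
  finally show ?thesis .
qed

text \<open>This is the vanishing of the covariant derivative of the metric. Of the six terms in the
  two lowered symbols, two agree and the other four cancel in pairs.\<close>

lemma metric_compatible:
  assumes "x \<in> U"
  shows "partial m (\<lambda>y. G y $ j $ k) x =
    (\<Sum>i\<in>UNIV. G x $ k $ i * \<Gamma> i j m x) + (\<Sum>i\<in>UNIV. G x $ j $ i * \<Gamma> i k m x)"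
  unfolding christoffel_lower[OF assms]
  using partial_sym_G[OF assms] by (simp add: algebra_simps)

text \<open>The first and third terms of the symbol cancel, since contraction with the symmetric
  inverse metric allows exchanging \<open>i\<close> and \<open>l\<close>. The right-hand side is the
  logarithmic derivative of the volume density.\<close>

lemma christoffel_trace:
  assumes "x \<in> U"
  shows "(\<Sum>i\<in>UNIV. \<Gamma> i i m x) = (1/2) * (\<Sum>i\<in>UNIV. \<Sum>l\<in>UNIV. Gi i l x * partial m (\<lambda>y. G y $ i $ l) x)"
proof -
  have sw: "(\<Sum>i\<in>UNIV. \<Sum>l\<in>UNIV. Gi i l x * partial i (\<lambda>y. G y $ m $ l) x)
     = (\<Sum>i\<in>UNIV. \<Sum>l\<in>UNIV. Gi i l x * partial l (\<lambda>y. G y $ i $ m) x)"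
    by (subst sum.swap) (simp add: sym_Gi[OF assms, of _ _] partial_sym_G[OF assms, of _ m])
  have "(\<Sum>i\<in>UNIV. \<Gamma> i i m x) = (1/2) *
     ((\<Sum>i\<in>UNIV. \<Sum>l\<in>UNIV. Gi i l x * partial i (\<lambda>y. G y $ m $ l) x)
    + (\<Sum>i\<in>UNIV. \<Sum>l\<in>UNIV. Gi i l x * partial m (\<lambda>y. G y $ i $ l) x)
    - (\<Sum>i\<in>UNIV. \<Sum>l\<in>UNIV. Gi i l x * partial l (\<lambda>y. G y $ i $ m) x))"
    unfolding christoffel_def
    by (simp add: sum_distrib_left sum.distrib sum_subtractf algebra_simps)
  then show ?thesis using sw by simp
qed

end

section \<open>Conformal change of the metric\<close>

text \<open>
  The pointwise algebra behind the conformal change of the Ricci tensor: \<open>C\<close> stands for the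
  Christoffel symbols, \<open>p\<close> for \<open>d\<phi>\<close>, \<open>V\<close> for the gradient of \<open>\<phi>\<close>, and \<open>D\<close> for the change of \<open>C\<close>.
\<close>

lemma conformal_ricci_quadratic:
  fixes g :: "'n::finite \<Rightarrow> 'n \<Rightarrow> real" and V p :: "'n \<Rightarrow> real" and C D :: "'n \<Rightarrow> 'n \<Rightarrow> 'n \<Rightarrow> real"
  defines "N \<equiv> real CARD('n)" and "P \<equiv> \<Sum>m\<in>UNIV. p m * V m"
  assumes g_sym: "\<And>i j. g i j = g j i" and lower: "\<And>i. (\<Sum>m\<in>UNIV. g i m * V m) = p i"
    and C_sym: "\<And>k i j. C k i j = C k j i"
    and D: "\<And>l i j. D l i j = kron l i * p j + kron l j * p i - g i j * V l"
  shows "(\<Sum>i\<in>UNIV. \<Sum>m\<in>UNIV. (C i i m + D i i m) * (C m j k + D m j k)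
      - (C i j m + D i j m) * (C m i k + D m i k)) =
    (\<Sum>i\<in>UNIV. \<Sum>m\<in>UNIV. C i i m * C m j k - C i j m * C m i k)
    + (N - 2) * (\<Sum>m\<in>UNIV. p m * C m j k) + (N - 2) * p j * p k - (N - 2) * g j k * P
    - g j k * (\<Sum>i\<in>UNIV. \<Sum>m\<in>UNIV. C i i m * V m)
    + (\<Sum>m\<in>UNIV. V m * ((\<Sum>i\<in>UNIV. g k i * C i j m) + (\<Sum>i\<in>UNIV. g j i * C i k m)))"
proof -
  have con1: "(\<Sum>m\<in>UNIV. F m * D m j k) = F j * p k + F k * p j - g j k * (\<Sum>m\<in>UNIV. F m * V m)"
    for F j k
  proof -
    have "(\<Sum>m\<in>UNIV. F m * D m j k) =
        (\<Sum>m\<in>UNIV. (F m * kron m j) * p k + (F m * kron m k) * p j - g j k * (F m * V m))"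
      unfolding D by (intro sum.cong refl) (simp add: algebra_simps)
    then show ?thesis
      by (simp only: sum.distrib sum_subtractf flip: sum_distrib_left sum_distrib_right) simp
  qed
  \<comment> \<open>Lowering \<open>V\<close> gives \<open>p\<close>, so the second and third terms
    of \<open>D\<close> both produce p_j V_i, with opposite signs.\<close>
  have DV: "(\<Sum>m\<in>UNIV. D i j m * V m) = kron i j * P" for i j
  proof -
    have "(\<Sum>m\<in>UNIV. D i j m * V m) =
        (\<Sum>m\<in>UNIV. kron i j * (p m * V m) + (kron i m * V m) * p j - (g j m * V m) * V i)"
      unfolding D by (intro sum.cong refl) (simp add: algebra_simps)
    then show ?thesis unfolding P_def
      by (simp only: sum.distrib sum_subtractf lower flip: sum_distrib_left sum_distrib_right) simp
  qed
  have D_sym: "D k i j = D k j i" for k i j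
    unfolding D using g_sym[of i j] by simp
  have tr: "(\<Sum>i\<in>UNIV. D i i m) = N * p m" for m
    using lower[of m] g_sym[of m] unfolding D N_def by (simp add: sum.distrib sum_subtractf)
  have cross: "(\<Sum>i\<in>UNIV. \<Sum>m\<in>UNIV. C i j m * D m i k) = (\<Sum>i\<in>UNIV. C i i j) * p k
      + (\<Sum>i\<in>UNIV. p i * C i j k) - (\<Sum>m\<in>UNIV. V m * (\<Sum>i\<in>UNIV. g k i * C i j m))" for j k
  proof -
    have "(\<Sum>i\<in>UNIV. \<Sum>m\<in>UNIV. g i k * (C i j m * V m)) = (\<Sum>m\<in>UNIV. V m * (\<Sum>i\<in>UNIV. g k i * C i j m))"
      using g_sym[of k] by (subst sum.swap) (simp add: sum_distrib_left mult_ac)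
    then show ?thesis
      unfolding con1 using C_sym[of _ j]
      by (simp add: sum.distrib sum_subtractf sum_distrib_left sum_distrib_right mult_ac)
  qed
  have t1: "(\<Sum>i\<in>UNIV. \<Sum>m\<in>UNIV. C i i m * D m j k) = (\<Sum>i\<in>UNIV. C i i j) * p k
      + (\<Sum>i\<in>UNIV. C i i k) * p j - g j k * (\<Sum>i\<in>UNIV. \<Sum>m\<in>UNIV. C i i m * V m)"
    unfolding con1 by (simp add: sum.distrib sum_subtractf sum_distrib_left sum_distrib_right)
  have t2: "(\<Sum>i\<in>UNIV. \<Sum>m\<in>UNIV. D i i m * C m j k) = N * (\<Sum>m\<in>UNIV. p m * C m j k)"
    by (subst sum.swap) (simp add: tr mult.assoc flip: sum_distrib_right sum_distrib_left)
  have t3: "(\<Sum>i\<in>UNIV. \<Sum>m\<in>UNIV. D i i m * D m j k) = N * (2 * p j * p k - g j k * P)"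
    by (subst sum.swap)
      (simp add: tr con1 P_def mult.assoc flip: sum_distrib_right sum_distrib_left)
  \<comment> \<open>By symmetry of \<open>C\<close> and \<open>D\<close> in the lower indices this
    is \<open>cross\<close> with \<open>j\<close> and \<open>k\<close> exchanged.\<close>
  have t4: "(\<Sum>i\<in>UNIV. \<Sum>m\<in>UNIV. D i j m * C m i k) = (\<Sum>i\<in>UNIV. C i i k) * p j
      + (\<Sum>i\<in>UNIV. p i * C i j k) - (\<Sum>m\<in>UNIV. V m * (\<Sum>i\<in>UNIV. g j i * C i k m))"
  proof -
    have "(\<Sum>i\<in>UNIV. \<Sum>m\<in>UNIV. D i j m * C m i k) = (\<Sum>m\<in>UNIV. \<Sum>i\<in>UNIV. C m k i * D i m j)"
      by (subst sum.swap) (simp add: C_sym[of _ _ k] D_sym[of _ j] mult.commute)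
    also have "\<dots> = (\<Sum>i\<in>UNIV. C i i k) * p j
      + (\<Sum>i\<in>UNIV. p i * C i k j) - (\<Sum>m\<in>UNIV. V m * (\<Sum>i\<in>UNIV. g j i * C i k m))"
      by (rule cross)
    finally show ?thesis by (simp add: C_sym[of _ k j])
  qed
  have t5: "(\<Sum>i\<in>UNIV. \<Sum>m\<in>UNIV. D i j m * D m i k) = (N + 2) * p j * p k - 2 * g j k * P"
  proof -
    have a: "(\<Sum>i\<in>UNIV. D i j i) = N * p j" using tr[of j] D_sym[of _ j] by simp
    have b: "(\<Sum>i\<in>UNIV. D i j k * p i) = 2 * p j * p k - g j k * P"
      using con1[of p j k] by (simp add: mult.commute P_def)
    have c: "(\<Sum>i\<in>UNIV. g i k * (kron i j * P)) = g j k * P"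
    proof -
      have "(\<Sum>i\<in>UNIV. g i k * (kron i j * P)) = (\<Sum>i\<in>UNIV. g i k * kron i j) * P"
        by (simp only: sum_distrib_right mult.assoc)
      then show ?thesis by simp
    qed
    have "(\<Sum>i\<in>UNIV. \<Sum>m\<in>UNIV. D i j m * D m i k) =
        (\<Sum>i\<in>UNIV. D i j i * p k) + (\<Sum>i\<in>UNIV. D i j k * p i) - (\<Sum>i\<in>UNIV. g i k * (kron i j * P))"
      unfolding con1 DV by (simp only: sum.distrib sum_subtractf)
    then show ?thesis
      unfolding b c sum_distrib_right[symmetric] a by (simp add: algebra_simps)
  qed
  \<comment> \<open>On collecting, the traces of \<open>C\<close> in \<open>t1\<close> cancel
    against those in \<open>cross\<close> and \<open>t4\<close>. The factor N - 2 arises three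
    times: as N - 1 - 1 for the terms linear in \<open>C\<close>, as 2 N - (N + 2) for p_j p_k, and
    from - N + 2 for g_jk P.\<close>
  have "(\<Sum>i\<in>UNIV. \<Sum>m\<in>UNIV. (C i i m + D i i m) * (C m j k + D m j k)
      - (C i j m + D i j m) * (C m i k + D m i k)) =
    (\<Sum>i\<in>UNIV. \<Sum>m\<in>UNIV. C i i m * C m j k - C i j m * C m i k)
    + (\<Sum>i\<in>UNIV. \<Sum>m\<in>UNIV. C i i m * D m j k) + (\<Sum>i\<in>UNIV. \<Sum>m\<in>UNIV. D i i m * C m j k)
    + (\<Sum>i\<in>UNIV. \<Sum>m\<in>UNIV. D i i m * D m j k) - (\<Sum>i\<in>UNIV. \<Sum>m\<in>UNIV. C i j m * D m i k)
    - (\<Sum>i\<in>UNIV. \<Sum>m\<in>UNIV. D i j m * C m i k) - (\<Sum>i\<in>UNIV. \<Sum>m\<in>UNIV. D i j m * D m i k)"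
    unfolding sum.distrib[symmetric] sum_subtractf[symmetric]
    by (intro sum.cong refl) (simp add: algebra_simps)
  then show ?thesis
    unfolding t1 t2 t3 t4 t5 cross sum.distrib distrib_left
    by (simp add: algebra_simps sum.distrib)
qed

lemma matrix_inv_unique:
  fixes M N :: "real ^ 'n ^ 'n"
  assumes "M ** N = mat 1"
  shows "matrix_inv M = N"
proof -
  have "invertible M" using assms invertible_right_inverse by blast
  then have "matrix_inv M ** (M ** N) = N"
    by (simp add: matrix_mul_assoc matrix_inv_works)
  then show ?thesis by (simp add: assms)
qed

lemma matrix_inv_scaleR:
  fixes M :: "real ^ 'n ^ 'n"
  assumes "invertible M" "c \<noteq> 0"
  shows "matrix_inv (c *\<^sub>R M) = inverse c *\<^sub>R matrix_inv M"
  using assms matrix_inv_works[OF assms(1)]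
  by (intro matrix_inv_unique) (simp add: scalar_matrix_assoc[symmetric] matrix_scalar_ac)

section \<open>Gradient and Laplacian in one chart; the Laplacian as a divergence\<close>

context coord_metric
begin

definition grad :: "(real ^ 'n \<Rightarrow> real) \<Rightarrow> 'n \<Rightarrow> real ^ 'n \<Rightarrow> real" where
  "grad h k x = (\<Sum>l\<in>UNIV. Gi k l x * partial l h x)"

lemma gradient_coord_nth: "gradient_coord G h x $ k = grad h k x"
  by (simp add: gradient_coord_def grad_def matrix_vector_mult_def)

lemma smooth_grad: "smooth_on U h \<Longrightarrow> smooth_on U (grad h k)"
  unfolding grad_def[abs_def] by (intro smooth_intros)

lemma lower_grad:
  assumes "x \<in> U"
  shows "(\<Sum>m\<in>UNIV. G x $ i $ m * grad h m x) = partial i h x"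
proof -
  have "(\<Sum>m\<in>UNIV. G x $ i $ m * grad h m x) =
      (\<Sum>l\<in>UNIV. (\<Sum>m\<in>UNIV. G x $ i $ m * Gi m l x) * partial l h x)"
    unfolding grad_def sum_distrib_left sum_distrib_right by (subst sum.swap) (simp add: mult_ac)
  then show ?thesis by (simp add: GGi[OF assms])
qed

text \<open>The exported constant takes \<open>G\<close> but not \<open>U\<close> as an argument, so
  restricting to a chart overlap leaves it unchanged.\<close>

definition laplacian_coord :: "(real ^ 'n \<Rightarrow> real) \<Rightarrow> real ^ 'n \<Rightarrow> real" where
  "laplacian_coord h x = (\<Sum>i\<in>UNIV. \<Sum>l\<in>UNIV. Gi i l x * hessian_coord G h x $ i $ l)"

text \<open>The squared norm as the pairing of dh with the gradient: free of square roots, hence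
  visibly smooth.\<close>

definition gradient_sq :: "(real ^ 'n \<Rightarrow> real) \<Rightarrow> real ^ 'n \<Rightarrow> real" where
  "gradient_sq h x = (\<Sum>m\<in>UNIV. partial m h x * grad h m x)"

text \<open>The conformal change of the Ricci tensor produces the divergence of the gradient, which
  has to be recognized as the trace of the Hessian.\<close>

lemma divergence_grad:
  assumes x: "x \<in> U" and h: "smooth_on U h"
  shows "(\<Sum>i\<in>UNIV. partial i (grad h i) x) + (\<Sum>i\<in>UNIV. \<Sum>m\<in>UNIV. \<Gamma> i i m x * grad h m x)
      = laplacian_coord h x"
proof -
  let ?V = "\<lambda>m. grad h m x" and ?dG = "\<lambda>i l m. partial i (\<lambda>y. G y $ l $ m) x"
  have dG: "(\<lambda>y. G y $ i $ j) differentiable (at x)" for i j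
      by (rule smooth_on_differentiable[OF smooth_G x])
  have dV: "grad h m differentiable (at x)" for m
      by (rule smooth_on_differentiable[OF smooth_grad[OF h] x])
  \<comment> \<open>Differentiating dh = G grad h, rather than the gradient, keeps derivatives of
    the inverse matrix out of the computation.\<close>
  have ddh: "partial i (partial l h) x
      = (\<Sum>m\<in>UNIV. ?dG i l m * ?V m + G x $ l $ m * partial i (grad h m) x)" for i l
  proof -
    have "partial i (partial l h) x = partial i (\<lambda>y. \<Sum>m\<in>UNIV. G y $ l $ m * grad h m y) x"
      by (rule partial_cong[OF open_U x]) (simp add: lower_grad)
    also have "\<dots> = (\<Sum>m\<in>UNIV. ?dG i l m * ?V m + G x $ l $ m * partial i (grad h m) x)"
      using dG dV by (subst partial_sum) (auto simp: partial_mult add.commute)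
    finally show ?thesis .
  qed
  have c: "(\<Sum>k\<in>UNIV. \<Gamma> k i l x * partial k h x)
      = (\<Sum>m\<in>UNIV. (1/2) * (?dG i l m + ?dG l i m - ?dG m i l) * ?V m)" for i l
  proof -
    have "(\<Sum>k\<in>UNIV. \<Gamma> k i l x * partial k h x) = (\<Sum>k\<in>UNIV. \<Sum>m\<in>UNIV. G x $ m $ k * \<Gamma> k i l x * ?V m)"
      by (simp add: sum_distrib_left mult_ac sym_G[OF x] flip: lower_grad[OF x])
    also have "\<dots> = (\<Sum>m\<in>UNIV. (\<Sum>k\<in>UNIV. G x $ m $ k * \<Gamma> k i l x) * ?V m)"
      by (subst sum.swap) (simp add: sum_distrib_right)
    finally show ?thesis by (simp only: christoffel_lower[OF x])
  qed
  have c': "(\<Sum>k\<in>UNIV. \<Gamma> k i l x * partial k h x) =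
      (1/2) * ((\<Sum>m\<in>UNIV. ?dG i l m * ?V m) + (\<Sum>m\<in>UNIV. ?dG l i m * ?V m)
          - (\<Sum>m\<in>UNIV. ?dG m i l * ?V m))" for i l
    unfolding c sum.distrib[symmetric] sum_subtractf[symmetric] sum_distrib_left
    by (intro sum.cong refl) (simp add: algebra_simps)
  have sw: "(\<Sum>i\<in>UNIV. \<Sum>l\<in>UNIV. \<Sum>m\<in>UNIV. Gi i l x * ?dG l i m * ?V m)
      = (\<Sum>i\<in>UNIV. \<Sum>l\<in>UNIV. \<Sum>m\<in>UNIV. Gi i l x * ?dG i l m * ?V m)"
    by (subst sum.swap) (simp add: sym_Gi[OF x])
  have e: "(\<Sum>i\<in>UNIV. \<Sum>l\<in>UNIV. Gi i l x * (\<Sum>m\<in>UNIV. G x $ l $ m * partial i (grad h m) x))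
      = (\<Sum>i\<in>UNIV. partial i (grad h i) x)"
  proof (rule sum.cong[OF refl])
    fix i
    have "(\<Sum>l\<in>UNIV. Gi i l x * (\<Sum>m\<in>UNIV. G x $ l $ m * partial i (grad h m) x))
       = (\<Sum>m\<in>UNIV. (\<Sum>l\<in>UNIV. Gi i l x * G x $ l $ m) * partial i (grad h m) x)"
      unfolding sum_distrib_left sum_distrib_right by (subst sum.swap) (simp add: mult_ac)
    then show "(\<Sum>l\<in>UNIV. Gi i l x * (\<Sum>m\<in>UNIV. G x $ l $ m * partial i (grad h m) x))
        = partial i (grad h i) x"
      by (simp add: GiG[OF x])
  qed
  have tr: "(\<Sum>i\<in>UNIV. \<Sum>m\<in>UNIV. \<Gamma> i i m x * ?V m)
      = (1/2) * (\<Sum>i\<in>UNIV. \<Sum>l\<in>UNIV. \<Sum>m\<in>UNIV. Gi i l x * ?dG m i l * ?V m)"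
  proof -
    have "(\<Sum>i\<in>UNIV. \<Sum>m\<in>UNIV. \<Gamma> i i m x * ?V m) = (\<Sum>m\<in>UNIV. (\<Sum>i\<in>UNIV. \<Gamma> i i m x) * ?V m)"
      by (subst sum.swap) (simp add: sum_distrib_right)
    also have "\<dots> = (1/2) * (\<Sum>m\<in>UNIV. \<Sum>i\<in>UNIV. \<Sum>l\<in>UNIV. Gi i l x * ?dG m i l * ?V m)"
      unfolding christoffel_trace[OF x] by (simp add: sum_distrib_right sum_distrib_left)
    also have "(\<Sum>m\<in>UNIV. \<Sum>i\<in>UNIV. \<Sum>l\<in>UNIV. Gi i l x * ?dG m i l * ?V m)
        = (\<Sum>i\<in>UNIV. \<Sum>l\<in>UNIV. \<Sum>m\<in>UNIV. Gi i l x * ?dG m i l * ?V m)"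
      by (subst sum.swap, rule sum.cong[OF refl], rule sum.swap)
    finally show ?thesis .
  qed
  \<comment> \<open>By \<open>sw\<close> the terms with \<open>?dG i l m\<close> and
    \<open>?dG l i m\<close> have total coefficient 1 - 1/2 - 1/2 = 0. The remaining half of
    \<open>?dG m i l\<close> is the contracted Christoffel symbol by \<open>tr\<close>.\<close>
  have "laplacian_coord h x = (\<Sum>i\<in>UNIV. \<Sum>l\<in>UNIV. (\<Sum>m\<in>UNIV. Gi i l x * ?dG i l m * ?V m)
     + Gi i l x * (\<Sum>m\<in>UNIV. G x $ l $ m * partial i (grad h m) x)
     - (1/2) * (\<Sum>m\<in>UNIV. Gi i l x * ?dG i l m * ?V m) - (1/2) * (\<Sum>m\<in>UNIV. Gi i l x * ?dG l i m * ?V m)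
     + (1/2) * (\<Sum>m\<in>UNIV. Gi i l x * ?dG m i l * ?V m))"
    unfolding laplacian_coord_def
  proof (intro sum.cong refl)
    fix i l
    have "hessian_coord G h x $ i $ l
        = (\<Sum>m\<in>UNIV. ?dG i l m * ?V m) + (\<Sum>m\<in>UNIV. G x $ l $ m * partial i (grad h m) x)
       - (1/2) * ((\<Sum>m\<in>UNIV. ?dG i l m * ?V m) + (\<Sum>m\<in>UNIV. ?dG l i m * ?V m)
           - (\<Sum>m\<in>UNIV. ?dG m i l * ?V m))"
      unfolding hessian_coord_def by (simp only: vec_lambda_beta ddh c' sum.distrib)
    then show "Gi i l x * hessian_coord G h x $ i $ l = (\<Sum>m\<in>UNIV. Gi i l x * ?dG i l m * ?V m)
     + Gi i l x * (\<Sum>m\<in>UNIV. G x $ l $ m * partial i (grad h m) x)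
     - (1/2) * (\<Sum>m\<in>UNIV. Gi i l x * ?dG i l m * ?V m) - (1/2) * (\<Sum>m\<in>UNIV. Gi i l x * ?dG l i m * ?V m)
     + (1/2) * (\<Sum>m\<in>UNIV. Gi i l x * ?dG m i l * ?V m)"
      by (simp only: mult.assoc flip: sum_distrib_left) (simp add: algebra_simps)
  qed
  also have "\<dots> = (\<Sum>i\<in>UNIV. partial i (grad h i) x) + (\<Sum>i\<in>UNIV. \<Sum>m\<in>UNIV. \<Gamma> i i m x * ?V m)"
    unfolding sum.distrib sum_subtractf sum_distrib_left[symmetric, of "1/2"] e tr sw by simp
  finally show ?thesis by simp
qed

end

locale conformal_change = coord_metric U G
  for U :: "(real ^ 'n::finite) set" and G :: "real ^ 'n \<Rightarrow> real ^ 'n ^ 'n" +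
  fixes \<phi> :: "real ^ 'n \<Rightarrow> real"
  assumes smooth_\<phi>: "smooth_on U \<phi>"
begin

definition Gh :: "real ^ 'n \<Rightarrow> real ^ 'n ^ 'n" where
  "Gh = (\<lambda>y. exp (2 * \<phi> y) *\<^sub>R G y)"

definition D :: "'n \<Rightarrow> 'n \<Rightarrow> 'n \<Rightarrow> real ^ 'n \<Rightarrow> real" where
  "D k i j x = kron k i * partial j \<phi> x + kron k j * partial i \<phi> x - G x $ i $ j * grad \<phi> k x"

lemma smooth_D: "smooth_on U (D k i j)"
  unfolding D_def[abs_def] by (intro smooth_intros smooth_grad smooth_\<phi>)

text \<open>The factor e^(2 \<phi>) of the differentiated metric cancels that of its inverse. The
  derivatives of \<phi> remain, and contracting them with the inverse metric gives two Kronecker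
  terms and the gradient.\<close>

lemma christoffel_conformal:
  assumes x: "x \<in> U"
  shows "christoffel Gh k i j x = \<Gamma> k i j x + D k i j x"
proof -
  have dG: "(\<lambda>y. G y $ i $ j) differentiable (at x)" for i j
      by (rule smooth_on_differentiable[OF smooth_G x])
  have d\<phi>: "\<phi> differentiable (at x)" by (rule smooth_on_differentiable[OF smooth_\<phi> x])
  have de: "(\<lambda>y. exp (2 * \<phi> y)) differentiable (at x)"
    by (rule smooth_on_differentiable[OF _ x]) (intro smooth_on_exp smooth_intros smooth_\<phi>)
  have inv: "matrix_inv (Gh x) $ k $ l = exp (- 2 * \<phi> x) * Gi k l x" for l
    unfolding Gh_def using matrix_inv_scaleR[OF invertible_G[OF x], of "exp (2 * \<phi> x)"]
    by (simp add: exp_minus)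
  have p: "partial m (\<lambda>y. Gh y $ a $ b) x =
      exp (2 * \<phi> x) * (partial m (\<lambda>y. G y $ a $ b) x + 2 * partial m \<phi> x * G x $ a $ b)" for m a b
  proof -
    have "partial m (\<lambda>y. exp (2 * \<phi> y)) x = exp (2 * \<phi> x) * (2 * partial m \<phi> x)"
      using partial_exp[of "\<lambda>y. 2 * \<phi> y" x m] partial_cmult[OF d\<phi>] d\<phi> by simp
    then show ?thesis
      unfolding Gh_def using partial_mult[OF de dG, of m a b] by (simp add: distrib_left)
  qed
  have e: "exp (- (2 * \<phi> x)) * (exp (2 * \<phi> x) * z) = z" for z :: real
    by (simp add: exp_minus)
  have split_sum: "(1/2) * (\<Sum>l\<in>UNIV. A l * (X l + 2 * Y l))
      = (1/2) * (\<Sum>l\<in>UNIV. A l * X l) + (\<Sum>l\<in>UNIV. A l * Y l)"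
    for A X Y :: "'n \<Rightarrow> real"
    by (simp add: distrib_left sum.distrib sum_distrib_left)
  have "christoffel Gh k i j x = (1/2) * (\<Sum>l\<in>UNIV. Gi k l x *
      (exp (- (2 * \<phi> x)) * (exp (2 * \<phi> x) *
      (partial i (\<lambda>y. G y $ j $ l) x + partial j (\<lambda>y. G y $ i $ l) x - partial l (\<lambda>y. G y $ i $ j) x
       + 2 * (partial i \<phi> x * G x $ j $ l + partial j \<phi> x * G x $ i $ l
           - partial l \<phi> x * G x $ i $ j)))))"
    unfolding christoffel_def inv p by (simp add: algebra_simps)
  also have "\<dots> = \<Gamma> k i j x + (\<Sum>l\<in>UNIV. Gi k l x *
       (partial i \<phi> x * G x $ j $ l + partial j \<phi> x * G x $ i $ l - partial l \<phi> x * G x $ i $ j))"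
    unfolding e christoffel_def by (rule split_sum)
  also have "(\<Sum>l\<in>UNIV. Gi k l x *
       (partial i \<phi> x * G x $ j $ l + partial j \<phi> x * G x $ i $ l - partial l \<phi> x * G x $ i $ j)) =
      (\<Sum>l\<in>UNIV. Gi k l x * G x $ l $ j) * partial i \<phi> x
          + (\<Sum>l\<in>UNIV. Gi k l x * G x $ l $ i) * partial j \<phi> x
      - G x $ i $ j * grad \<phi> k x"
  proof -
    have sum3: "(\<Sum>l\<in>UNIV. A l * (p * X l + q * Y l - Z l * r)) =
        (\<Sum>l\<in>UNIV. A l * X l) * p + (\<Sum>l\<in>UNIV. A l * Y l) * q - r * (\<Sum>l\<in>UNIV. A l * Z l)"
      for A X Y Z :: "'n \<Rightarrow> real" and p q r
      unfolding sum_distrib_left sum_distrib_right sum.distrib[symmetric] sum_subtractf[symmetric]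
      by (intro sum.cong refl) (simp add: algebra_simps)
    have row: "(\<lambda>l. Gi k l x * G x $ l $ a) = (\<lambda>l. Gi k l x * G x $ a $ l)" for a
      using sym_G[OF x] by auto
    show ?thesis unfolding sum3 row grad_def by (rule refl)
  qed
  also have "\<Gamma> k i j x + \<dots> = \<Gamma> k i j x + D k i j x"
    by (simp add: GiG[OF x] D_def)
  finally show ?thesis .
qed

text \<open>The metric enters the Hessian only through the connection, so the change is
  \<open>D\<close> contracted with dh.\<close>

lemma hessian_conformal:
  assumes x: "x \<in> U"
  shows "hessian_coord Gh h x $ i $ j = hessian_coord G h x $ i $ j
    - partial i \<phi> x * partial j h x - partial j \<phi> x * partial i h x
    + G x $ i $ j * (\<Sum>k\<in>UNIV. grad \<phi> k x * partial k h x)"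
proof -
  have "(\<Sum>k\<in>UNIV. D k i j x * partial k h x) =
      (\<Sum>k\<in>UNIV. (kron k i * partial k h x) * partial j \<phi> x + (kron k j * partial k h x) * partial i \<phi> x
       - G x $ i $ j * (grad \<phi> k x * partial k h x))"
    unfolding D_def by (intro sum.cong refl) (simp add: algebra_simps)
  also have "\<dots> = partial i h x * partial j \<phi> x + partial j h x * partial i \<phi> x
      - G x $ i $ j * (\<Sum>k\<in>UNIV. grad \<phi> k x * partial k h x)"
    by (simp only: sum.distrib sum_subtractf flip: sum_distrib_left sum_distrib_right) simp
  finally show ?thesis
    unfolding hessian_coord_def by (simp add: christoffel_conformal[OF x] distrib_right sum.distrib)
qed

lemma trace_D:
  assumes x: "x \<in> U"
  shows "(\<Sum>i\<in>UNIV. D i i k x) = real CARD('n) * partial k \<phi> x"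
  using lower_grad[OF x, of k \<phi>] sym_G[OF x, of k]
  unfolding D_def by (simp add: sum.distrib sum_subtractf)

text \<open>Substituting \<Gamma> + D into the curvature, the derivatives of \<open>D\<close> give -
  (n - 2) times the second derivatives of \<phi> together with a divergence; the products are sorted
  by \<open>conformal_ricci_quadratic\<close>. The linear \<Gamma> terms complete these to the
  Hessian and the Laplacian.\<close>

lemma ricci_conformal:
  assumes x: "x \<in> U"
  shows "ricci_coord Gh x $ j $ k = ricci_coord G x $ j $ k
    - (real CARD('n) - 2) * (hessian_coord G \<phi> x $ j $ k - partial j \<phi> x * partial k \<phi> x)
    - (laplacian_coord \<phi> x + (real CARD('n) - 2) * gradient_sq \<phi> x) * G x $ j $ k"
proof -
  let ?N = "real CARD('n)"
  have d\<Gamma>: "\<Gamma> l i j differentiable (at x)" for l i j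
      by (rule smooth_on_differentiable[OF smooth_christoffel x])
  have dD: "D l i j differentiable (at x)" for l i j by (rule smooth_on_differentiable[OF smooth_D x])
  have dG: "(\<lambda>y. G y $ i $ j) differentiable (at x)" for i j
      by (rule smooth_on_differentiable[OF smooth_G x])
  have dV: "grad \<phi> m differentiable (at x)" for m
      by (rule smooth_on_differentiable[OF smooth_grad[OF smooth_\<phi>] x])
  have dp: "partial m \<phi> differentiable (at x)" for m
    by (rule smooth_on_differentiable[OF smooth_on_partial[OF smooth_\<phi>] x])
  have pC: "partial m (christoffel Gh l a b) x = partial m (\<Gamma> l a b) x + partial m (D l a b) x"
      for m l a b
    using partial_cong[OF open_U x christoffel_conformal] partial_add[OF d\<Gamma> dD] by simp
  have pD: "partial i (D i j k) x
      = kron i j * partial i (partial k \<phi>) x + kron i k * partial i (partial j \<phi>) x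
      - (partial i (\<lambda>y. G y $ j $ k) x * grad \<phi> i x + G x $ j $ k * partial i (grad \<phi> i) x)" for i
  proof -
    have "partial i (D i j k) x
        = partial i (\<lambda>y. kron i j * partial k \<phi> y + kron i k * partial j \<phi> y
        - G y $ j $ k * grad \<phi> i y) x"
      unfolding D_def[abs_def] by (rule refl)
    then show ?thesis
      using dp dG dV by (simp add: partial_diff partial_add partial_cmult partial_mult)
  qed
  have "(\<Sum>i\<in>UNIV. partial i (D i j k) x) = partial j (partial k \<phi>) x + partial k (partial j \<phi>) x
      - ((\<Sum>i\<in>UNIV. partial i (\<lambda>y. G y $ j $ k) x * grad \<phi> i x)
          + G x $ j $ k * (\<Sum>i\<in>UNIV. partial i (grad \<phi> i) x))"
    unfolding pD by (simp add: sum.distrib sum_subtractf sum_distrib_left)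
  then have s1: "(\<Sum>i\<in>UNIV. partial i (D i j k) x) = 2 * partial j (partial k \<phi>) x
      - ((\<Sum>i\<in>UNIV. partial i (\<lambda>y. G y $ j $ k) x * grad \<phi> i x)
          + G x $ j $ k * (\<Sum>i\<in>UNIV. partial i (grad \<phi> i) x))"
    using partial_commute[OF open_U smooth_\<phi> x, of k j] by simp
  \<comment> \<open>Taking the trace before differentiating replaces the sum by n d\<phi>.\<close>
  have s2: "(\<Sum>i\<in>UNIV. partial j (D i i k) x) = ?N * partial j (partial k \<phi>) x"
  proof -
    have "(\<Sum>i\<in>UNIV. partial j (D i i k) x) = partial j (\<lambda>y. \<Sum>i\<in>UNIV. D i i k y) x"
      using dD by (simp add: partial_sum)
    also have "\<dots> = partial j (\<lambda>y. ?N * partial k \<phi> y) x"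
      by (rule partial_cong[OF open_U x trace_D])
    finally show ?thesis using dp by (simp add: partial_cmult)
  qed
  have "ricci_coord Gh x $ j $ k = (\<Sum>i\<in>UNIV. partial i (\<Gamma> i j k) x - partial j (\<Gamma> i i k) x)
      + (\<Sum>i\<in>UNIV. partial i (D i j k) x) - (\<Sum>i\<in>UNIV. partial j (D i i k) x)
      + (\<Sum>i\<in>UNIV. \<Sum>m\<in>UNIV. (\<Gamma> i i m x + D i i m x) * (\<Gamma> m j k x + D m j k x)
      - (\<Gamma> i j m x + D i j m x) * (\<Gamma> m i k x + D m i k x))"
    unfolding ricci_coord_def riemann_def
    by (simp add: pC christoffel_conformal[OF x] sum.distrib sum_subtractf algebra_simps)
  also have "(\<Sum>i\<in>UNIV. \<Sum>m\<in>UNIV. (\<Gamma> i i m x + D i i m x) * (\<Gamma> m j k x + D m j k x)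
      - (\<Gamma> i j m x + D i j m x) * (\<Gamma> m i k x + D m i k x)) =
    (\<Sum>i\<in>UNIV. \<Sum>m\<in>UNIV. \<Gamma> i i m x * \<Gamma> m j k x - \<Gamma> i j m x * \<Gamma> m i k x)
    + (?N - 2) * (\<Sum>m\<in>UNIV. partial m \<phi> x * \<Gamma> m j k x) + (?N - 2) * partial j \<phi> x * partial k \<phi> x
    - (?N - 2) * G x $ j $ k * gradient_sq \<phi> x
    - G x $ j $ k * (\<Sum>i\<in>UNIV. \<Sum>m\<in>UNIV. \<Gamma> i i m x * grad \<phi> m x)
    + (\<Sum>m\<in>UNIV. grad \<phi> m x * ((\<Sum>i\<in>UNIV. G x $ k $ i * \<Gamma> i j m x) + (\<Sum>i\<in>UNIV. G x $ j $ i * \<Gamma> i k m x)))"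
    unfolding gradient_sq_def
    by (rule conformal_ricci_quadratic)
      (use sym_G[OF x] lower_grad[OF x] christoffel_sym[OF x] D_def in auto)
  \<comment> \<open>Metric compatibility makes this the derivative of \<open>G\<close> along the
    gradient, which cancels the same term with opposite sign in \<open>s1\<close>.\<close>
  also have "(\<Sum>m\<in>UNIV. grad \<phi> m x * ((\<Sum>i\<in>UNIV. G x $ k $ i * \<Gamma> i j m x)
      + (\<Sum>i\<in>UNIV. G x $ j $ i * \<Gamma> i k m x)))
     = (\<Sum>i\<in>UNIV. partial i (\<lambda>y. G y $ j $ k) x * grad \<phi> i x)"
    by (simp only: metric_compatible[OF x] mult.commute)
  finally have R: "ricci_coord Gh x $ j $ k = (\<Sum>i\<in>UNIV. partial i (\<Gamma> i j k) x - partial j (\<Gamma> i i k) x)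
    + (\<Sum>i\<in>UNIV. \<Sum>m\<in>UNIV. \<Gamma> i i m x * \<Gamma> m j k x - \<Gamma> i j m x * \<Gamma> m i k x)
    - (?N - 2) * (partial j (partial k \<phi>) x - (\<Sum>m\<in>UNIV. partial m \<phi> x * \<Gamma> m j k x)
        - partial j \<phi> x * partial k \<phi> x)
    - ((\<Sum>i\<in>UNIV. partial i (grad \<phi> i) x) + (\<Sum>i\<in>UNIV. \<Sum>m\<in>UNIV. \<Gamma> i i m x * grad \<phi> m x)
        + (?N - 2) * gradient_sq \<phi> x) * G x $ j $ k"
    unfolding s1 s2 by (simp add: algebra_simps)
  have "ricci_coord G x $ j $ k = (\<Sum>i\<in>UNIV. partial i (\<Gamma> i j k) x - partial j (\<Gamma> i i k) x)
    + (\<Sum>i\<in>UNIV. \<Sum>m\<in>UNIV. \<Gamma> i i m x * \<Gamma> m j k x - \<Gamma> i j m x * \<Gamma> m i k x)"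
    unfolding ricci_coord_def riemann_def by (simp add: sum.distrib)
  then show ?thesis
    unfolding R divergence_grad[OF x smooth_\<phi>] hessian_coord_def by (simp add: mult.commute)
qed

end

section \<open>Links to the trace and norm on the manifold, and the chain rule for
  exponentials\<close>

context coord_metric
begin

lemma gradient_sq_eq_inner: "gradient_sq h x
    = (\<chi> m. partial m h x) \<bullet> (matrix_inv (G x) *v (\<chi> m. partial m h x))"
  by (simp add: gradient_sq_def grad_def inner_vec_def matrix_vector_mult_def)

lemma gradient_inner:
  assumes "x \<in> U"
  shows "gradient_coord G h x \<bullet> (G x *v gradient_coord G h x) = gradient_sq h x"
proof -
  have "(G x *v gradient_coord G h x) $ i = partial i h x" for i
    using lower_grad[OF assms] by (simp add: matrix_vector_mult_def gradient_coord_nth)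
  then show ?thesis
    by (simp add: inner_vec_def gradient_coord_nth gradient_sq_def mult.commute)
qed

lemma trace_hessian:
  assumes "x \<in> U"
  shows "trace (matrix_inv (G x) ** hessian_coord G h x) = laplacian_coord h x"
proof -
  have "trace (matrix_inv (G x) ** hessian_coord G h x) =
      (\<Sum>i\<in>UNIV. \<Sum>l\<in>UNIV. Gi i l x * hessian_coord G h x $ l $ i)"
    by (simp add: trace_def matrix_matrix_mult_def)
  also have "\<dots> = laplacian_coord h x"
    unfolding laplacian_coord_def by (subst sum.swap) (simp add: sym_Gi[OF assms])
  finally show ?thesis .
qed

lemma smooth_hessian: "smooth_on U h \<Longrightarrow> smooth_on U (\<lambda>x. hessian_coord G h x $ i $ j)"
  unfolding hessian_coord_def by (simp, intro smooth_intros smooth_christoffel)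

lemma smooth_laplacian_coord: "smooth_on U h \<Longrightarrow> smooth_on U (laplacian_coord h)"
  unfolding laplacian_coord_def[abs_def] by (intro smooth_intros smooth_hessian)

lemma smooth_gradient_sq: "smooth_on U h \<Longrightarrow> smooth_on U (gradient_sq h)"
  unfolding gradient_sq_def[abs_def] by (intro smooth_intros smooth_grad)

text \<open>Both rest on the Hessian of e^(a h), which is e^(a h) times a Hess h + a^2 dh dh. They
  serve to express the terms of \<beta> through f.\<close>

lemma
  assumes h: "smooth_on U h" and x: "x \<in> U"
  shows gradient_sq_exp: "gradient_sq (\<lambda>y. exp (a * h y)) x = a\<^sup>2 * (exp (a * h x))\<^sup>2 * gradient_sq h x"
    and laplacian_coord_exp: "laplacian_coord (\<lambda>y. exp (a * h y)) x
        = exp (a * h x) * (a * laplacian_coord h x + a\<^sup>2 * gradient_sq h x)"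
proof -
  let ?e = "\<lambda>y. exp (a * h y)"
  have dh: "h differentiable (at y)" if "y \<in> U" for y by (rule smooth_on_differentiable[OF h that])
  have de: "?e differentiable (at x)"
    by (rule smooth_on_differentiable[OF _ x]) (intro smooth_on_exp smooth_intros h)
  have p: "partial j ?e y = a * ?e y * partial j h y" if "y \<in> U" for j y
    using partial_exp[of "\<lambda>y. a * h y" y j] partial_cmult[OF dh[OF that]] dh[OF that] by simp
  have pp: "partial i (partial j ?e) x
      = a * ?e x * partial i (partial j h) x + a\<^sup>2 * ?e x * (partial i h x * partial j h x)" for i j
  proof -
    have dp: "partial j h differentiable (at x)"
        by (rule smooth_on_differentiable[OF smooth_on_partial[OF h] x])
    have "partial i (partial j ?e) x = partial i (\<lambda>y. a * (?e y * partial j h y)) x"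
      by (rule partial_cong[OF open_U x]) (simp add: p)
    also have "\<dots> = a * (?e x * partial i (partial j h) x + (a * ?e x * partial i h x) * partial j h x)"
      using de dp by (simp add: partial_cmult partial_mult p[OF x])
    finally show ?thesis by (simp add: algebra_simps power2_eq_square)
  qed
  have g: "grad ?e m x = a * ?e x * grad h m x" for m
    unfolding grad_def by (simp add: p[OF x] sum_distrib_left mult_ac)
  show "gradient_sq ?e x = a\<^sup>2 * (?e x)\<^sup>2 * gradient_sq h x"
    unfolding gradient_sq_def g by (simp add: p[OF x] sum_distrib_left power2_eq_square mult_ac)
  have H: "hessian_coord G ?e x $ i $ j = a * ?e x * hessian_coord G h x $ i $ j
      + a\<^sup>2 * ?e x * (partial i h x * partial j h x)" for i j
    unfolding hessian_coord_def by (simp add: pp p[OF x] sum_distrib_left algebra_simps)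
  have s: "gradient_sq h x = (\<Sum>i\<in>UNIV. \<Sum>j\<in>UNIV. Gi i j x * (partial i h x * partial j h x))"
    unfolding gradient_sq_def grad_def by (simp add: sum_distrib_left mult_ac)
  have "laplacian_coord ?e x = (\<Sum>i\<in>UNIV. \<Sum>j\<in>UNIV. a * ?e x * (Gi i j x * hessian_coord G h x $ i $ j)
      + a\<^sup>2 * ?e x * (Gi i j x * (partial i h x * partial j h x)))"
    unfolding laplacian_coord_def H by (simp add: algebra_simps)
  also have "\<dots> = a * ?e x * laplacian_coord h x + a\<^sup>2 * ?e x * gradient_sq h x"
    unfolding s laplacian_coord_def by (simp only: sum.distrib sum_distrib_left)
  finally show "laplacian_coord ?e x = ?e x * (a * laplacian_coord h x + a\<^sup>2 * gradient_sq h x)"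
    by (simp add: algebra_simps)
qed

end

section \<open>Change of charts\<close>

text \<open>\<open>W\<close> will be a chart overlap seen in the first chart, \<open>U\<close> the
  full image of the second and \<psi> the transition map. Invertibility of the Jacobian follows from
  \<open>G_pullback\<close>, by comparing determinants.\<close>

locale coord_change = src: coord_metric W G + tgt: coord_metric U G'
  for W :: "(real ^ 'n::finite) set" and G and U :: "(real ^ 'n) set" and G' +
  fixes \<psi> :: "real ^ 'n \<Rightarrow> real ^ 'n"
  assumes smooth_\<psi>: "smooth_on W \<psi>" and \<psi>_into: "x \<in> W \<Longrightarrow> \<psi> x \<in> U"
    and G_pullback: "x \<in> W \<Longrightarrow>
      G x = transpose (jacobian \<psi> (at x)) ** G' (\<psi> x) ** jacobian \<psi> (at x)"
begin

abbreviation "J a i x \<equiv> jacobian \<psi> (at x) $ a $ i"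

lemma diff_\<psi>: "x \<in> W \<Longrightarrow> \<psi> differentiable (at x)"
  by (rule smooth_on_differentiable[OF smooth_\<psi>])

lemma diff_compose:
  assumes "smooth_on U u" "x \<in> W"
  shows "(\<lambda>y. u (\<psi> y)) differentiable (at x)"
  using differentiable_chain_at[OF diff_\<psi> smooth_on_differentiable[OF assms(1) \<psi>_into]] assms(2)
  by (simp add: o_def)

lemma partial_pullback:
  assumes "smooth_on U u" "x \<in> W"
  shows "partial i (\<lambda>y. u (\<psi> y)) x = (\<Sum>a\<in>UNIV. J a i x * partial a u (\<psi> x))"
  by (rule partial_compose[OF diff_\<psi>[OF assms(2)]
      smooth_on_differentiable[OF assms(1) \<psi>_into[OF assms(2)]]])

lemma smooth_comp_\<psi>: "smooth_on W (\<lambda>y. \<psi> y $ a)"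
  by (rule smooth_on_vec_nth[OF src.open_U smooth_\<psi>])

lemma J_eq: "x \<in> W \<Longrightarrow> J a i x = partial i (\<lambda>y. \<psi> y $ a) x"
  using partial_vec_nth[OF diff_\<psi>] by simp

lemma smooth_J: "smooth_on W (J a i)"
proof -
  have "smooth_on W (J a i) \<longleftrightarrow> smooth_on W (partial i (\<lambda>y. \<psi> y $ a))"
    by (rule smooth_on_cong[OF src.open_U J_eq])
  then show ?thesis using smooth_on_partial[OF smooth_comp_\<psi>] by simp
qed

lemma diff_J: "x \<in> W \<Longrightarrow> J a i differentiable (at x)"
  by (rule smooth_on_differentiable[OF smooth_J])

text \<open>The entries of the Jacobian are first partials of the components of \<psi>, so this is
  the symmetry of second derivatives.\<close>

lemma partial_J_sym:
  assumes "x \<in> W"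
  shows "partial i (J a j) x = partial j (J a i) x"
proof -
  have "partial i (J a j) x = partial i (partial j (\<lambda>y. \<psi> y $ a)) x" for i j
    by (rule partial_cong[OF src.open_U assms J_eq])
  then show ?thesis using partial_commute[OF src.open_U smooth_comp_\<psi> assms] by simp
qed

text \<open>Product rule for J^T G' J. Symmetry of \<open>G'\<close> brings the terms from the two
  Jacobians to one shape with \<open>j\<close> and \<open>l\<close> exchanged, which is what makes
  them cancel in the Christoffel combination.\<close>

lemma partial_G_pullback:
  assumes x: "x \<in> W"
  shows "partial i (\<lambda>y. G y $ j $ l) x =
      (\<Sum>a\<in>UNIV. \<Sum>b\<in>UNIV. partial i (J a j) x * G' (\<psi> x) $ a $ b * J b l x)
    + (\<Sum>a\<in>UNIV. \<Sum>b\<in>UNIV. partial i (J a l) x * G' (\<psi> x) $ a $ b * J b j x)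
    + (\<Sum>c\<in>UNIV. \<Sum>a\<in>UNIV. \<Sum>b\<in>UNIV. J c i x * J a j x * J b l x * partial c (\<lambda>y. G' y $ a $ b) (\<psi> x))"
proof -
  let ?G = "\<lambda>a b. G' (\<psi> x) $ a $ b"
  have dG: "(\<lambda>y. G' (\<psi> y) $ a $ b) differentiable (at x)" for a b
    by (rule diff_compose[OF tgt.smooth_G x])
  have pG: "partial i (\<lambda>y. G' (\<psi> y) $ a $ b) x
      = (\<Sum>c\<in>UNIV. J c i x * partial c (\<lambda>y. G' y $ a $ b) (\<psi> x))" for a b
    by (rule partial_pullback[OF tgt.smooth_G x])
  have "partial i (\<lambda>y. G y $ j $ l) x
      = partial i (\<lambda>y. \<Sum>b\<in>UNIV. \<Sum>a\<in>UNIV. J a j y * G' (\<psi> y) $ a $ b * J b l y) x"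
    by (rule partial_cong[OF src.open_U x])
      (simp add: G_pullback matrix_matrix_mult_def transpose_def sum_distrib_right)
  also have "\<dots> = (\<Sum>b\<in>UNIV. \<Sum>a\<in>UNIV. J a j x * ?G a b * partial i (J b l) x
      + (J a j x * partial i (\<lambda>y. G' (\<psi> y) $ a $ b) x + partial i (J a j) x * ?G a b) * J b l x)"
    using dG diff_J[OF x] by (simp add: partial_sum partial_mult)
  also have "\<dots> = (\<Sum>b\<in>UNIV. \<Sum>a\<in>UNIV. partial i (J b l) x * ?G b a * J a j x)
      + (\<Sum>b\<in>UNIV. \<Sum>a\<in>UNIV. partial i (J a j) x * ?G a b * J b l x)
      + (\<Sum>b\<in>UNIV. \<Sum>a\<in>UNIV. \<Sum>c\<in>UNIV. J c i x * J a j x * J b l x * partial c (\<lambda>y. G' y $ a $ b) (\<psi> x))"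
    unfolding pG sum.distrib[symmetric]
  proof (intro sum.cong refl)
    fix b a
    show "J a j x * ?G a b * partial i (J b l) x
      + (J a j x * (\<Sum>c\<in>UNIV. J c i x * partial c (\<lambda>y. G' y $ a $ b) (\<psi> x))
          + partial i (J a j) x * ?G a b) * J b l x
      = partial i (J b l) x * ?G b a * J a j x + partial i (J a j) x * ?G a b * J b l x
      + (\<Sum>c\<in>UNIV. J c i x * J a j x * J b l x * partial c (\<lambda>y. G' y $ a $ b) (\<psi> x))"
      unfolding tgt.sym_G[OF \<psi>_into[OF x], of b a]
      by (simp add: algebra_simps sum_distrib_left)
  qed
  also have "(\<Sum>b\<in>UNIV. \<Sum>a\<in>UNIV. partial i (J a j) x * ?G a b * J b l x)
     = (\<Sum>a\<in>UNIV. \<Sum>b\<in>UNIV. partial i (J a j) x * ?G a b * J b l x)"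
    by (rule sum.swap)
  also have "(\<Sum>b\<in>UNIV. \<Sum>a\<in>UNIV. \<Sum>c\<in>UNIV. J c i x * J a j x * J b l x * partial c (\<lambda>y. G' y $ a $ b) (\<psi> x))
     = (\<Sum>b\<in>UNIV. \<Sum>c\<in>UNIV. \<Sum>a\<in>UNIV. J c i x * J a j x * J b l x * partial c (\<lambda>y. G' y $ a $ b) (\<psi> x))"
    by (rule sum.cong[OF refl], rule sum.swap)
  also have "\<dots> = (\<Sum>c\<in>UNIV. \<Sum>b\<in>UNIV. \<Sum>a\<in>UNIV. J c i x * J a j x * J b l x * partial c (\<lambda>y. G' y $ a $ b) (\<psi> x))"
    by (rule sum.swap)
  also have "\<dots> = (\<Sum>c\<in>UNIV. \<Sum>a\<in>UNIV. \<Sum>b\<in>UNIV. J c i x * J a j x * J b l x * partial c (\<lambda>y. G' y $ a $ b) (\<psi> x))"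
    by (rule sum.cong[OF refl], rule sum.swap)
  finally show ?thesis by simp
qed

text \<open>The transformation law, with the Jacobian kept on the left instead of its inverse on the
  right. The second derivatives of \<psi> express that the symbols do not form a tensor.\<close>

lemma christoffel_pullback:
  assumes x: "x \<in> W"
  shows "(\<Sum>k\<in>UNIV. J b k x * christoffel G k i j x) = partial i (J b j) x
    + (\<Sum>c\<in>UNIV. \<Sum>a\<in>UNIV. J c i x * J a j x * christoffel G' b c a (\<psi> x))"
proof -
  let ?J = "jacobian \<psi> (at x)" and ?G = "\<lambda>a b. G' (\<psi> x) $ a $ b"
  let ?M = "transpose ?J ** G' (\<psi> x)"
  let ?C = "\<lambda>b c a. christoffel G' b c a (\<psi> x)"
  let ?dG = "\<lambda>c a b. partial c (\<lambda>y. G' y $ a $ b) (\<psi> x)"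
  \<comment> \<open>Both sides agree after lowering the index \<open>b\<close>, that is, after multiplying by the invertible \<open>?M\<close>.\<close>
  define X where "X = (\<chi> b. \<Sum>k\<in>UNIV. J b k x * christoffel G k i j x)"
  define Y where "Y = (\<chi> b. partial i (J b j) x + (\<Sum>c\<in>UNIV. \<Sum>a\<in>UNIV. J c i x * J a j x * ?C b c a))"
  have inv: "invertible ?M"
    using src.invertible_G[OF x] unfolding G_pullback[OF x] invertible_det_nz by (simp add: det_mul)
  have MX: "(?M *v X) $ l = (\<Sum>k\<in>UNIV. G x $ l $ k * christoffel G k i j x)" for l
  proof -
    have "X = ?J *v (\<chi> k. christoffel G k i j x)"
      by (simp add: X_def matrix_vector_mult_def)
    then have "?M *v X = G x *v (\<chi> k. christoffel G k i j x)"
      by (simp add: matrix_vector_mul_assoc G_pullback[OF x])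
    then show ?thesis by (simp add: matrix_vector_mult_def)
  qed
  have MY: "(?M *v Y) $ l = (\<Sum>a\<in>UNIV. \<Sum>b\<in>UNIV. partial i (J a j) x * ?G a b * J b l x)
     + (\<Sum>c\<in>UNIV. \<Sum>a\<in>UNIV. \<Sum>d\<in>UNIV. J c i x * J a j x * J d l x * (\<Sum>b\<in>UNIV. ?G d b * ?C b c a))" for l
  proof -
    have "(?M *v Y) $ l = (\<Sum>b\<in>UNIV. \<Sum>d\<in>UNIV. J d l x * ?G d b * partial i (J b j) x)
      + (\<Sum>b\<in>UNIV. \<Sum>d\<in>UNIV. J d l x * ?G d b * (\<Sum>c\<in>UNIV. \<Sum>a\<in>UNIV. J c i x * J a j x * ?C b c a))"
      by (simp add: matrix_vector_mult_def matrix_matrix_mult_def transpose_def Y_def distrib_left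
           sum_distrib_right sum.distrib)
    also have "(\<Sum>b\<in>UNIV. \<Sum>d\<in>UNIV. J d l x * ?G d b * partial i (J b j) x)
       = (\<Sum>a\<in>UNIV. \<Sum>b\<in>UNIV. partial i (J a j) x * ?G a b * J b l x)"
      by (intro sum.cong refl) (simp add: tgt.sym_G[OF \<psi>_into[OF x]])
    also have "(\<Sum>b\<in>UNIV. \<Sum>d\<in>UNIV. J d l x * ?G d b * (\<Sum>c\<in>UNIV. \<Sum>a\<in>UNIV. J c i x * J a j x * ?C b c a))
       = (\<Sum>b\<in>UNIV. \<Sum>d\<in>UNIV. \<Sum>c\<in>UNIV. \<Sum>a\<in>UNIV. J c i x * J a j x * J d l x * (?G d b * ?C b c a))"
      by (intro sum.cong refl) (simp add: sum_distrib_left mult_ac)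
    also have "\<dots> = (\<Sum>d\<in>UNIV. \<Sum>b\<in>UNIV. \<Sum>c\<in>UNIV. \<Sum>a\<in>UNIV. J c i x * J a j x * J d l x * (?G d b * ?C b c a))"
      by (rule sum.swap)
    also have "\<dots> = (\<Sum>d\<in>UNIV. \<Sum>c\<in>UNIV. \<Sum>b\<in>UNIV. \<Sum>a\<in>UNIV. J c i x * J a j x * J d l x * (?G d b * ?C b c a))"
      by (rule sum.cong[OF refl], rule sum.swap)
    also have "\<dots> = (\<Sum>d\<in>UNIV. \<Sum>c\<in>UNIV. \<Sum>a\<in>UNIV. \<Sum>b\<in>UNIV. J c i x * J a j x * J d l x * (?G d b * ?C b c a))"
      by (rule sum.cong[OF refl], rule sum.cong[OF refl], rule sum.swap)
    also have "\<dots> = (\<Sum>c\<in>UNIV. \<Sum>d\<in>UNIV. \<Sum>a\<in>UNIV. \<Sum>b\<in>UNIV. J c i x * J a j x * J d l x * (?G d b * ?C b c a))"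
      by (rule sum.swap)
    also have "\<dots> = (\<Sum>c\<in>UNIV. \<Sum>a\<in>UNIV. \<Sum>d\<in>UNIV. \<Sum>b\<in>UNIV. J c i x * J a j x * J d l x * (?G d b * ?C b c a))"
      by (rule sum.cong[OF refl], rule sum.swap)
    finally show ?thesis by (simp only: sum_distrib_left)
  qed
  have "?M *v X = ?M *v Y"
  proof (rule vec_eq_iff[THEN iffD2], rule allI)
    fix l
    \<comment> \<open>\<open>?A\<close> collects second derivatives of \<psi> and is symmetric in
      its first two arguments, so the Christoffel combination of its six instances reduces to 2
      \<open>?A i j l\<close>. \<open>?K\<close> collects derivatives of \<open>G'\<close>;
      \<open>K1\<close> and \<open>K2\<close> rename summation indices until all three instances
      carry the same Jacobian factors.\<close>
    let ?A = "\<lambda>i j l. \<Sum>a\<in>UNIV. \<Sum>b\<in>UNIV. partial i (J a j) x * ?G a b * J b l x"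
    let ?K = "\<lambda>i j l. \<Sum>c\<in>UNIV. \<Sum>a\<in>UNIV. \<Sum>b\<in>UNIV. J c i x * J a j x * J b l x * ?dG c a b"
    have A_sym: "?A i j l = ?A j i l" for i j l by (simp add: partial_J_sym[OF x, of i _ j])
    have K1: "?K j i l = (\<Sum>c\<in>UNIV. \<Sum>a\<in>UNIV. \<Sum>b\<in>UNIV. J c i x * J a j x * J b l x * ?dG a c b)"
      by (subst sum.swap) (simp add: mult_ac)
    have K2: "?K l i j = (\<Sum>c\<in>UNIV. \<Sum>a\<in>UNIV. \<Sum>b\<in>UNIV. J c i x * J a j x * J b l x * ?dG b c a)"
    proof -
      have "?K l i j = (\<Sum>b\<in>UNIV. \<Sum>c\<in>UNIV. \<Sum>a\<in>UNIV. J c i x * J a j x * J b l x * ?dG b c a)"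
        by (simp add: mult_ac)
      also have "\<dots> = (\<Sum>c\<in>UNIV. \<Sum>b\<in>UNIV. \<Sum>a\<in>UNIV. J c i x * J a j x * J b l x * ?dG b c a)"
        by (rule sum.swap)
      also have "\<dots> = (\<Sum>c\<in>UNIV. \<Sum>a\<in>UNIV. \<Sum>b\<in>UNIV. J c i x * J a j x * J b l x * ?dG b c a)"
        by (rule sum.cong[OF refl], rule sum.swap)
      finally show ?thesis .
    qed
    have "(?M *v X) $ l = (1/2) * ((?A i j l + ?A i l j + ?K i j l) + (?A j i l + ?A j l i + ?K j i l)
        - (?A l i j + ?A l j i + ?K l i j))"
      unfolding MX src.christoffel_lower[OF x] partial_G_pullback[OF x] by (rule refl)
    also have "\<dots> = ?A i j l + (1/2) * (?K i j l + ?K j i l - ?K l i j)"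
      using A_sym[of j i l] A_sym[of l i j] A_sym[of l j i] by simp
    also have "(1/2) * (?K i j l + ?K j i l - ?K l i j) =
       (\<Sum>c\<in>UNIV. \<Sum>a\<in>UNIV. \<Sum>d\<in>UNIV. J c i x * J a j x * J d l x * (\<Sum>b\<in>UNIV. ?G d b * ?C b c a))"
      unfolding K1 K2 tgt.christoffel_lower[OF \<psi>_into[OF x]] sum.distrib[symmetric]
        sum_subtractf[symmetric] sum_distrib_left
      by (intro sum.cong refl) (simp add: algebra_simps)
    finally show "(?M *v X) $ l = (?M *v Y) $ l" unfolding MY .
  qed
  then have "X = Y" using inj_matrix_vector_mult[OF inv] by (auto dest: injD)
  then have "X $ b = Y $ b" by simp
  then show ?thesis by (simp add: X_def Y_def)
qed

context
  fixes h h' :: "real ^ 'n \<Rightarrow> real"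
  assumes smooth_h': "smooth_on U h'" and h_pullback: "\<And>x. x \<in> W \<Longrightarrow> h x = h' (\<psi> x)"
begin

lemma partial_h:
  assumes "x \<in> W"
  shows "partial i h x = (\<Sum>a\<in>UNIV. J a i x * partial a h' (\<psi> x))"
  using partial_cong[OF src.open_U assms h_pullback] partial_pullback[OF smooth_h' assms] by simp

text \<open>The chain rule for second derivatives leaves a term \<open>partial i (J a j)\<close>
  times dh'; the inhomogeneous term of \<open>christoffel_pullback\<close> cancels exactly
  this.\<close>

lemma hessian_pullback:
  assumes x: "x \<in> W"
  shows "hessian_coord G h x =
    transpose (jacobian \<psi> (at x)) ** hessian_coord G' h' (\<psi> x) ** jacobian \<psi> (at x)"
proof -
  let ?h = "\<lambda>b. partial b h' (\<psi> x)" and ?hh = "\<lambda>c a. partial c (partial a h') (\<psi> x)"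
  let ?C = "\<lambda>b c a. christoffel G' b c a (\<psi> x)"
  have "hessian_coord G h x $ i $ j =
    (transpose (jacobian \<psi> (at x)) ** hessian_coord G' h' (\<psi> x) ** jacobian \<psi> (at x)) $ i $ j" for i j
  proof -
    have "partial i (partial j h) x = partial i (\<lambda>y. \<Sum>a\<in>UNIV. J a j y * partial a h' (\<psi> y)) x"
      by (rule partial_cong[OF src.open_U x partial_h])
    also have "\<dots> = (\<Sum>a\<in>UNIV. J a j x * (\<Sum>c\<in>UNIV. J c i x * ?hh c a) + partial i (J a j) x * ?h a)"
      using diff_J[OF x] diff_compose[OF smooth_on_partial[OF smooth_h'] x]
      by (simp add: partial_sum partial_mult partial_pullback[OF smooth_on_partial[OF smooth_h'] x])
    also have "\<dots> = (\<Sum>a\<in>UNIV. \<Sum>c\<in>UNIV. J c i x * J a j x * ?hh c a)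
        + (\<Sum>a\<in>UNIV. partial i (J a j) x * ?h a)"
      by (simp add: sum.distrib sum_distrib_left mult_ac)
    finally have pp: "partial i (partial j h) x =
      (\<Sum>a\<in>UNIV. \<Sum>c\<in>UNIV. J c i x * J a j x * ?hh c a) + (\<Sum>a\<in>UNIV. partial i (J a j) x * ?h a)" .
    have "(\<Sum>k\<in>UNIV. christoffel G k i j x * partial k h x) =
        (\<Sum>k\<in>UNIV. \<Sum>b\<in>UNIV. J b k x * christoffel G k i j x * ?h b)"
      by (simp add: partial_h[OF x] sum_distrib_left mult_ac)
    also have "\<dots> = (\<Sum>b\<in>UNIV. (\<Sum>k\<in>UNIV. J b k x * christoffel G k i j x) * ?h b)"
      by (subst sum.swap) (simp add: sum_distrib_right)
    also have "\<dots> = (\<Sum>b\<in>UNIV. partial i (J b j) x * ?h b)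
        + (\<Sum>b\<in>UNIV. \<Sum>c\<in>UNIV. \<Sum>a\<in>UNIV. J c i x * J a j x * (?C b c a * ?h b))"
      unfolding christoffel_pullback[OF x] distrib_right sum.distrib
      by (simp add: sum_distrib_left sum_distrib_right mult_ac)
    also have "(\<Sum>b\<in>UNIV. \<Sum>c\<in>UNIV. \<Sum>a\<in>UNIV. J c i x * J a j x * (?C b c a * ?h b))
      = (\<Sum>c\<in>UNIV. \<Sum>b\<in>UNIV. \<Sum>a\<in>UNIV. J c i x * J a j x * (?C b c a * ?h b))"
      by (rule sum.swap)
    also have "\<dots> = (\<Sum>c\<in>UNIV. \<Sum>a\<in>UNIV. \<Sum>b\<in>UNIV. J c i x * J a j x * (?C b c a * ?h b))"
      by (rule sum.cong[OF refl], rule sum.swap)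
    also have "\<dots> = (\<Sum>a\<in>UNIV. \<Sum>c\<in>UNIV. \<Sum>b\<in>UNIV. J c i x * J a j x * (?C b c a * ?h b))"
      by (rule sum.swap)
    finally have "hessian_coord G h x $ i $ j = (\<Sum>a\<in>UNIV. \<Sum>c\<in>UNIV. J c i x * J a j x * ?hh c a)
        - (\<Sum>a\<in>UNIV. \<Sum>c\<in>UNIV. \<Sum>b\<in>UNIV. J c i x * J a j x * (?C b c a * ?h b))"
      unfolding hessian_coord_def by (simp add: pp)
    also have "\<dots> = (\<Sum>a\<in>UNIV. \<Sum>c\<in>UNIV. J c i x * (?hh c a - (\<Sum>b\<in>UNIV. ?C b c a * ?h b)) * J a j x)"
      unfolding sum_subtractf[symmetric]
      by (intro sum.cong refl) (simp add: algebra_simps sum_distrib_left)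
    finally show ?thesis
      by (simp add: matrix_matrix_mult_def transpose_def hessian_coord_def sum_distrib_right)
  qed
  then show ?thesis by (simp add: vec_eq_iff)
qed

text \<open>Multiplying the left-hand side by J^T G' gives G G^-1 J^T = J^T, and J^T can be
  cancelled.\<close>

lemma matrix_inv_pullback:
  assumes x: "x \<in> W"
  shows "jacobian \<psi> (at x) ** matrix_inv (G x) ** transpose (jacobian \<psi> (at x)) = matrix_inv (G' (\<psi> x))"
proof -
  let ?J = "jacobian \<psi> (at x)"
  have inv: "invertible (transpose ?J)"
    using src.invertible_G[OF x] unfolding G_pullback[OF x] invertible_det_nz by (simp add: det_mul)
  have "transpose ?J ** (G' (\<psi> x) ** (?J ** matrix_inv (G x) ** transpose ?J)) = transpose ?J"
    using matrix_inv_works(1)[OF src.invertible_G[OF x]]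
    by (simp add: matrix_mul_assoc flip: G_pullback[OF x])
  then have "matrix_inv (transpose ?J)
      ** (transpose ?J ** (G' (\<psi> x) ** (?J ** matrix_inv (G x) ** transpose ?J))) = mat 1"
    using matrix_inv_works(2)[OF inv] by simp
  then have "G' (\<psi> x) ** (?J ** matrix_inv (G x) ** transpose ?J) = mat 1"
    unfolding matrix_mul_assoc[of "matrix_inv (transpose ?J)"] matrix_inv_works(2)[OF inv] by simp
  then show ?thesis by (rule matrix_inv_unique[symmetric])
qed

text \<open>Cyclicity of the trace moves the Jacobian from the Hessian to the inverse
  metric.\<close>

lemma laplacian_coord_pullback:
  assumes x: "x \<in> W"
  shows "src.laplacian_coord h x = tgt.laplacian_coord h' (\<psi> x)"
proof -
  let ?J = "jacobian \<psi> (at x)"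
  have "src.laplacian_coord h x
      = trace ((matrix_inv (G x) ** transpose ?J ** hessian_coord G' h' (\<psi> x)) ** ?J)"
    using src.trace_hessian[OF x, of h] by (simp add: hessian_pullback[OF x] matrix_mul_assoc)
  also have "\<dots> = trace (matrix_inv (G' (\<psi> x)) ** hessian_coord G' h' (\<psi> x))"
    unfolding matrix_inv_pullback[OF x, symmetric]
        by (subst trace_mul_sym) (simp only: matrix_mul_assoc)
  also have "\<dots> = tgt.laplacian_coord h' (\<psi> x)"
    by (rule tgt.trace_hessian[OF \<psi>_into[OF x]])
  finally show ?thesis .
qed

lemma gradient_sq_pullback:
  assumes x: "x \<in> W"
  shows "src.gradient_sq h x = tgt.gradient_sq h' (\<psi> x)"
proof -
  let ?J = "jacobian \<psi> (at x)" and ?d = "\<chi> m. partial m h' (\<psi> x)"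
  have d: "(\<chi> m. partial m h x) = transpose ?J *v ?d"
    by (simp add: vec_eq_iff partial_h[OF x] matrix_vector_mult_def transpose_def)
  have "src.gradient_sq h x = ?d \<bullet> (?J *v (matrix_inv (G x) *v (transpose ?J *v ?d)))"
    unfolding src.gradient_sq_eq_inner d
    by (simp only: transpose_matrix_vector dot_lmul_matrix)
  also have "\<dots> = ?d \<bullet> (matrix_inv (G' (\<psi> x)) *v ?d)"
    unfolding matrix_inv_pullback[OF x, symmetric]
        by (simp only: matrix_vector_mul_assoc matrix_mul_assoc)
  finally show ?thesis unfolding tgt.gradient_sq_eq_inner .
qed

end
end

section \<open>Constant multiples and the soliton expression in one chart\<close>

context coord_metric
begin

lemma coord_metric_subset:
  assumes "open W" "W \<subseteq> U"
  shows "coord_metric W G"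
  using assms smooth_G sym_G invertible_G
  by unfold_locales (auto intro: smooth_on_subset)

lemma
  assumes h: "smooth_on U h" and x: "x \<in> U"
  shows partial_cmult_at: "partial i (\<lambda>y. c * h y) x = c * partial i h x"
    and grad_cmult: "grad (\<lambda>y. c * h y) i x = c * grad h i x"
    and hessian_cmult: "hessian_coord G (\<lambda>y. c * h y) x $ i $ j = c * hessian_coord G h x $ i $ j"
    and laplacian_coord_cmult: "laplacian_coord (\<lambda>y. c * h y) x = c * laplacian_coord h x"
    and gradient_sq_cmult: "gradient_sq (\<lambda>y. c * h y) x = c\<^sup>2 * gradient_sq h x"
proof -
  have p: "partial i (\<lambda>y. c * h y) y = c * partial i h y" if "y \<in> U" for i y
    by (rule partial_cmult[OF smooth_on_differentiable[OF h that]])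
  have pp: "partial i (partial j (\<lambda>y. c * h y)) x = c * partial i (partial j h) x" for i j
    using partial_cong[OF open_U x p] partial_cmult[OF
        smooth_on_differentiable[OF smooth_on_partial[OF h] x]] by simp
  show "partial i (\<lambda>y. c * h y) x = c * partial i h x" by (rule p[OF x])
  have g: "grad (\<lambda>y. c * h y) i x = c * grad h i x" for i
    unfolding grad_def by (simp add: p[OF x] sum_distrib_left mult_ac)
  then show "grad (\<lambda>y. c * h y) i x = c * grad h i x" .
  have H: "hessian_coord G (\<lambda>y. c * h y) x $ i $ j = c * hessian_coord G h x $ i $ j" for i j
    unfolding hessian_coord_def
    by (simp add: p[OF x] pp sum_distrib_left right_diff_distrib mult_ac)
  then show "hessian_coord G (\<lambda>y. c * h y) x $ i $ j = c * hessian_coord G h x $ i $ j" .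
  show "laplacian_coord (\<lambda>y. c * h y) x = c * laplacian_coord h x"
    unfolding laplacian_coord_def H by (simp add: sum_distrib_left mult_ac)
  show "gradient_sq (\<lambda>y. c * h y) x = c\<^sup>2 * gradient_sq h x"
    unfolding gradient_sq_def g p[OF x] by (simp add: sum_distrib_left power2_eq_square mult_ac)
qed

lemma soliton_conformal:
  assumes f: "smooth_on U f" and x: "x \<in> U" and a: "(real CARD('n) - 2) * a = 2"
    and Gh: "Gh = (\<lambda>y. exp (2 * (- a * f y)) *\<^sub>R G y)"
  shows "ricci_coord Gh x + hessian_coord Gh (\<lambda>y. - f y) x =
    ricci_coord G x + hessian_coord G f x + (a * laplacian_coord f x - a * gradient_sq f x) *\<^sub>R G x"
proof -
  let ?\<phi> = "\<lambda>y. - a * f y"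
  interpret C: conformal_change U G ?\<phi>
    by unfold_locales (intro smooth_intros f)
  have Gh_eq: "Gh = C.Gh" by (simp only: Gh C.Gh_def)
  \<comment> \<open>Brings - f under the rules for constant multiples, with factor - 1.\<close>
  have minus: "(\<lambda>y. - f y) = (\<lambda>y. (-1) * f y)" by simp
  have g: "(\<Sum>k\<in>UNIV. grad ?\<phi> k x * partial k (\<lambda>y. (-1) * f y) x) = a * gradient_sq f x"
    unfolding grad_cmult[OF f x] partial_cmult_at[OF f x] gradient_sq_def
    by (simp add: sum_distrib_left mult_ac)
  have "ricci_coord Gh x $ i $ j + hessian_coord Gh (\<lambda>y. - f y) x $ i $ j =
    ricci_coord G x $ i $ j + hessian_coord G f x $ i $ j
        + (a * laplacian_coord f x - a * gradient_sq f x) * G x $ i $ j" for i j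
  proof -
    let ?N = "real CARD('n)" and ?H = "hessian_coord G f x $ i $ j" and ?P = "gradient_sq f x"
      and ?fi = "partial i f x" and ?fj = "partial j f x"
    \<comment> \<open>Subtracted in the Ricci formula, this contributes twice the Hessian of f, of
      which the Hessian of - f takes one back; the product term meets its negative there.\<close>
    have e: "(?N - 2) * (- a * ?H - - a * ?fi * (- a * ?fj)) = - 2 * ?H - 2 * (a * ?fi * ?fj)"
    proof -
      have "(?N - 2) * (- a * ?H - - a * ?fi * (- a * ?fj)) = ((?N - 2) * a) * (- ?H - a * ?fi * ?fj)"
        by (simp add: algebra_simps)
      then show ?thesis unfolding a by simp
    qed
    \<comment> \<open>Enters with a minus sign; the pairing \<open>g\<close> from the new Hessian
      restores a |df|^2, leaving - a |df|^2.\<close>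
    have e': "(?N - 2) * ((- a)\<^sup>2 * ?P) = 2 * a * ?P"
    proof -
      have "(?N - 2) * ((- a)\<^sup>2 * ?P) = ((?N - 2) * a) * (a * ?P)"
        by (simp add: power2_eq_square)
      then show ?thesis unfolding a by simp
    qed
    show ?thesis
      unfolding Gh_eq minus C.ricci_conformal[OF x] C.hessian_conformal[OF x]
      unfolding g
      unfolding hessian_cmult[OF f x] laplacian_coord_cmult[OF f x] gradient_sq_cmult[OF f x]
          partial_cmult_at[OF f x] e e'
      by (simp add: algebra_simps)
  qed
  then show ?thesis by (simp add: vec_eq_iff)
qed

end

section \<open>Charts\<close>

lemma is_chartD:
  assumes "is_chart X c"
  shows "openin X (fst c)" "open (snd c ` fst c)"
    "homeomorphic_map (subtopology X (fst c)) (top_of_set (snd c ` fst c)) (snd c)"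
  using assms by (simp_all only: is_chart_def)

lemma chart_inv_left:
  assumes "is_chart X c" "p \<in> fst c"
  shows "chart_inv c (snd c p) = p"
proof -
  have "topspace (subtopology X (fst c)) = fst c"
    by (rule topspace_subtopology_subset[OF openin_subset[OF is_chartD(1)[OF assms(1)]]])
  then have "inj_on (snd c) (fst c)"
    using homeomorphic_imp_injective_map[OF is_chartD(3)[OF assms(1)]] by (simp only:)
  then show ?thesis unfolding chart_inv_def using assms(2) by (rule inv_into_f_f)
qed

text \<open>A chart is an open map onto its image, and that image is itself open; derivatives on an
  overlap therefore make sense.\<close>

lemma open_chart_image:
  assumes "is_chart X c" "is_chart X d"
  shows "open (snd c ` (fst c \<inter> fst d))"
proof -
  have "openin (subtopology X (fst c)) (fst c \<inter> fst d)"
    by (rule openin_subtopology_Int2[OF is_chartD(1)[OF assms(2)]])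
  then have "openin (top_of_set (snd c ` fst c)) (snd c ` (fst c \<inter> fst d))"
    using homeomorphic_imp_open_map[OF is_chartD(3)[OF assms(1)]] unfolding open_map_def by blast
  then show ?thesis
    using is_chartD(2)[OF assms(1)] by (rule openin_open_trans)
qed

locale riemannian_manifold =
  fixes X :: "'a topology" and A :: "('a, 'n::finite) chart set" and g :: "('a, 'n) tensor02"
  assumes manifold: "smooth_manifold X A" and metric: "riemannian_metric A g"
begin

abbreviation "G c \<equiv> g c \<circ> chart_inv c"
abbreviation "img c \<equiv> snd c ` fst c"

lemma is_chart: "c \<in> A \<Longrightarrow> is_chart X c"
  using manifold by (simp add: smooth_manifold_def)

lemma inv_left: "c \<in> A \<Longrightarrow> p \<in> fst c \<Longrightarrow> chart_inv c (snd c p) = p"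
  by (rule chart_inv_left[OF is_chart])

lemma open_img: "c \<in> A \<Longrightarrow> open (img c)"
  by (rule is_chartD(2)[OF is_chart])

lemma smooth_G: "c \<in> A \<Longrightarrow> smooth_on (img c) (G c)"
  using metric unfolding riemannian_metric_def smooth_tensor02_def by blast

lemma G_transform:
  assumes "c \<in> A" "d \<in> A" "p \<in> fst c" "p \<in> fst d"
  shows "g c p = transpose (jacobian (transition c d) (at (snd c p))) ** g d p **
    jacobian (transition c d) (at (snd c p))"
  using metric assms unfolding riemannian_metric_def smooth_tensor02_def Let_def by blast

lemma G_sym: "c \<in> A \<Longrightarrow> p \<in> fst c \<Longrightarrow> transpose (g c p) = g c p"
  using metric unfolding riemannian_metric_def by blast

lemma G_pos: "c \<in> A \<Longrightarrow> p \<in> fst c \<Longrightarrow> v \<noteq> 0 \<Longrightarrow> v \<bullet> (g c p *v v) > 0"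
  using metric unfolding riemannian_metric_def by blast

lemma coord_metric:
  assumes "c \<in> A"
  shows "coord_metric (img c) (G c)"
proof
  show "open (img c)" by (rule open_img[OF assms])
  show "smooth_on (img c) (\<lambda>x. G c x $ i $ j)" for i j
    using smooth_on_vec_nth[OF _ smooth_on_vec_nth[OF _ smooth_G[OF assms]]] open_img[OF assms] by blast
  fix x i j
  assume "x \<in> img c"
  then obtain p where p: "p \<in> fst c" "x = snd c p" by blast
  then have G: "G c x = g c p" using inv_left[OF assms] by simp
  have "g c p $ i $ j = transpose (g c p) $ j $ i" by (simp add: transpose_def)
  then show "G c x $ i $ j = G c x $ j $ i" unfolding G G_sym[OF assms p(1)] .
  have "v = 0" if "g c p *v v = 0" for v
    using G_pos[OF assms p(1), of v] that by (cases "v = 0") auto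
  then show "invertible (G c x)"
    unfolding G by (auto simp: invertible_left_inverse matrix_left_invertible_ker)
qed

lemma coord_change:
  assumes "c \<in> A" "d \<in> A"
  shows "coord_change (snd c ` (fst c \<inter> fst d)) (G c) (img d) (G d) (transition c d)"
proof -
  interpret d: coord_metric "img d" "G d" by (rule coord_metric[OF assms(2)])
  interpret c: coord_metric "snd c ` (fst c \<inter> fst d)" "G c"
    using open_chart_image[OF is_chart[OF assms(1)] is_chart[OF assms(2)]]
    by (rule coord_metric.coord_metric_subset[OF coord_metric[OF assms(1)]]) auto
  show ?thesis
  proof
    show "smooth_on (snd c ` (fst c \<inter> fst d)) (transition c d)"
      using manifold assms by (simp add: smooth_manifold_def)
    fix x
    assume "x \<in> snd c ` (fst c \<inter> fst d)"
    then obtain p where p: "p \<in> fst c" "p \<in> fst d" "x = snd c p" by blast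
    then have t: "transition c d x = snd d p" by (simp add: transition_def inv_left[OF assms(1)])
    show "transition c d x \<in> img d" using p t by simp
    show "G c x = transpose (jacobian (transition c d) (at x)) ** G d (transition c d x)
        ** jacobian (transition c d) (at x)"
      using G_transform[OF assms p(1,2)] unfolding t unfolding p(3)
      by (simp only: o_apply inv_left[OF assms(1) p(1)] inv_left[OF assms(2) p(2)])
  qed
qed

context
  fixes h :: "'a \<Rightarrow> real"
  assumes h: "smooth_function A h"
begin

lemma smooth_h: "c \<in> A \<Longrightarrow> smooth_on (img c) (h \<circ> chart_inv c)"
  using h by (simp add: smooth_function_def)

text \<open>The pullback lemmas are applied on the overlap, with the transition map sending
  \<open>snd c p\<close> to \<open>snd d p\<close>.\<close>

lemma
  assumes c: "c \<in> A" "p \<in> fst c" and d: "d \<in> A" "p \<in> fst d"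
  shows laplacian_coord_chart: "coord_metric.laplacian_coord (G c) (h \<circ> chart_inv c) (snd c p) =
      coord_metric.laplacian_coord (G d) (h \<circ> chart_inv d) (snd d p)"
    and gradient_sq_chart: "coord_metric.gradient_sq (G c) (h \<circ> chart_inv c) (snd c p) =
      coord_metric.gradient_sq (G d) (h \<circ> chart_inv d) (snd d p)"
proof -
  interpret coord_change "snd c ` (fst c \<inter> fst d)" "G c" "img d" "G d" "transition c d"
    by (rule coord_change[OF c(1) d(1)])
  have t: "transition c d (snd c p) = snd d p" by (simp add: transition_def inv_left[OF c])
  have pull: "(h \<circ> chart_inv c) x = (h \<circ> chart_inv d) (transition c d x)"
    if "x \<in> snd c ` (fst c \<inter> fst d)" for x
    using that by (auto simp: transition_def inv_left c(1) d(1))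
  have "snd c p \<in> snd c ` (fst c \<inter> fst d)" using c d by simp
  from laplacian_coord_pullback[OF smooth_h[OF d(1)] pull this]
      gradient_sq_pullback[OF smooth_h[OF d(1)] pull this]
  show "src.laplacian_coord (h \<circ> chart_inv c) (snd c p)
      = tgt.laplacian_coord (h \<circ> chart_inv d) (snd d p)"
    "src.gradient_sq (h \<circ> chart_inv c) (snd c p) = tgt.gradient_sq (h \<circ> chart_inv d) (snd d p)"
    unfolding t by (auto simp: o_def)
qed

text \<open>The chart \<open>c\<close> around \<open>p\<close> gives uniqueness: with no chart
  there, every real would satisfy the description.\<close>

lemma chart_value_eq:
  assumes "c \<in> A" "p \<in> fst c" "\<And>d. d \<in> A \<Longrightarrow> p \<in> fst d \<Longrightarrow> F d p = r"
  shows "chart_value A F p = r"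
  unfolding chart_value_def using assms by (intro the_equality) auto

lemma laplacian_eq:
  assumes c: "c \<in> A" "p \<in> fst c"
  shows "laplacian A g h p = coord_metric.laplacian_coord (G c) (h \<circ> chart_inv c) (snd c p)"
  unfolding laplacian_def
proof (rule chart_value_eq[OF c])
  fix d
  assume d: "d \<in> A" "p \<in> fst d"
  then have "trace (matrix_inv (G d (snd d p)) ** hessian_coord (G d) (h \<circ> chart_inv d) (snd d p)) =
      coord_metric.laplacian_coord (G d) (h \<circ> chart_inv d) (snd d p)"
    by (intro coord_metric.trace_hessian[OF coord_metric]) auto
  then show "trace (matrix_inv (g d p) ** hessian g h d p)
      = coord_metric.laplacian_coord (G c) (h \<circ> chart_inv c) (snd c p)"
    unfolding laplacian_coord_chart[OF c d] by (simp add: hessian_def inv_left[OF d])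
qed

lemma metric_norm_gradient:
  assumes c: "c \<in> A" "p \<in> fst c"
  shows "(metric_norm A g (gradient g h) p)\<^sup>2
      = coord_metric.gradient_sq (G c) (h \<circ> chart_inv c) (snd c p)"
proof -
  have sq: "gradient g h d p \<bullet> (g d p *v gradient g h d p)
      = coord_metric.gradient_sq (G c) (h \<circ> chart_inv c) (snd c p)"
    if d: "d \<in> A" "p \<in> fst d" for d
  proof -
    have "snd d p \<in> img d" using d by simp
    from coord_metric.gradient_inner[OF coord_metric[OF d(1)] this, of "h \<circ> chart_inv d"]
    show ?thesis unfolding gradient_sq_chart[OF c d] by (simp add: gradient_def inv_left[OF d])
  qed
  then have "metric_norm A g (gradient g h) p
      = sqrt (coord_metric.gradient_sq (G c) (h \<circ> chart_inv c) (snd c p))"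
    unfolding metric_norm_def by (intro chart_value_eq[OF c]) simp
  \<comment> \<open>Positivity of the metric makes squaring undo the square root.\<close>
  moreover have "0 \<le> gradient g h c p \<bullet> (g c p *v gradient g h c p)"
    using G_pos[OF c] by (cases "gradient g h c p = 0") (auto intro: less_imp_le)
  ultimately show ?thesis using sq[OF c] by simp
qed

end

lemma riemannian_metric_scaleR:
  assumes s: "\<And>p. s p > 0" and smooth: "smooth_function A s"
  shows "riemannian_metric A (\<lambda>c p. s p *\<^sub>R g c p)"
  unfolding riemannian_metric_def smooth_tensor02_def
proof (intro conjI ballI)
  fix c
  assume c: "c \<in> A"
  have "smooth_on (img c) (\<lambda>x. (s \<circ> chart_inv c) x *\<^sub>R G c x)"
  proof (intro smooth_on_scaleR open_img smooth_G c)
    show "smooth_on (img c) (s \<circ> chart_inv c)" using smooth c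
        by (simp add: smooth_function_def del: o_apply)
  qed
  then show "smooth_on (img c) ((\<lambda>p. s p *\<^sub>R g c p) \<circ> chart_inv c)" by (simp add: o_def)
next
  fix c d p
  assume "c \<in> A" "d \<in> A" "p \<in> fst c \<inter> fst d"
  then show "let J = jacobian (transition c d) (at (snd c p))
      in s p *\<^sub>R g c p = transpose J ** (s p *\<^sub>R g d p) ** J"
    unfolding Let_def using G_transform[of c d p]
    by (simp only: matrix_scalar_ac scalar_matrix_assoc[symmetric] Int_iff)
next
  fix c p
  assume "c \<in> A" "p \<in> fst c"
  then show "transpose (s p *\<^sub>R g c p) = s p *\<^sub>R g c p"
    and "\<forall>v. v \<noteq> 0 \<longrightarrow> 0 < v \<bullet> ((s p *\<^sub>R g c p) *v v)"
    using G_sym G_pos s[of p] by (auto simp: transpose_scalar simp flip: scaleR_matrix_vector_assoc)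
qed

end

theorem proposition2p1:
  fixes X :: "'a topology" and A :: "('a, 'n::finite) chart set"
    and g ghat :: "('a, 'n) tensor02"
    and f fhat lam lamhat \<tau> \<beta> \<delta> :: "'a \<Rightarrow> real"
    and T :: "real \<Rightarrow> real" and n :: real
  assumes "smooth_manifold X A"
    and "n = real CARD('n)" and "CARD('n) > 2"
    and "almost_soliton_with A g f lam"
    and "T = (\<lambda>s. exp (2 * s / (n - 2)))" and "\<tau> = (\<lambda>p. T (f p))"
    and "ghat = (\<lambda>c p. (1 / (\<tau> p)\<^sup>2) *\<^sub>R g c p)" and "fhat = (\<lambda>p. - f p)"
    and "\<beta> = (\<lambda>p. inverse (\<tau> p) * laplacian A g \<tau> p
                 - (n - 1) * inverse ((\<tau> p)\<^sup>2) * (metric_norm A g (gradient g \<tau>) p)\<^sup>2)"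
    and "\<delta> = (\<lambda>p. inverse (\<tau> p) * deriv T (f p) * (metric_norm A g (gradient g f) p)\<^sup>2)"
    and "lamhat = (\<lambda>p. (\<tau> p)\<^sup>2 * (lam p + \<beta> p + \<delta> p))"
  shows "almost_soliton_pair A ghat fhat \<and> almost_soliton_with A ghat fhat lamhat"
proof -
  have metric: "riemannian_metric A g" and f: "smooth_function A f" and lam: "smooth_function A lam"
    and soliton: "\<And>c p. c \<in> A \<Longrightarrow> p \<in> fst c \<Longrightarrow> ricci g c p + hessian g f c p = lam p *\<^sub>R g c p"
    using assms(4) by (auto simp: almost_soliton_with_def)
  interpret riemannian_manifold X A g by unfold_locales (rule assms(1), rule metric)
  define a where "a = 2 / (n - 2)"
  have a: "(real CARD('n) - 2) * a = 2"
  proof -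
    have "n - 2 \<noteq> 0" using assms(2,3) by simp
    then show ?thesis
      unfolding a_def assms(2)[symmetric] times_divide_eq_right
      by (rule nonzero_mult_div_cancel_left)
  qed
  have T: "T = (\<lambda>s. exp (a * s))" unfolding assms(5) a_def by simp
  have \<tau>: "\<tau> = (\<lambda>p. exp (a * f p))" unfolding assms(6) T by (rule refl)
  have scale: "1 / (\<tau> p)\<^sup>2 = exp (2 * (- a * f p))" for p
    unfolding \<tau> by (simp add: exp_minus exp_double divide_inverse)
  have \<tau>_nonzero: "\<tau> p \<noteq> 0" for p unfolding \<tau> by simp
  have dT: "deriv T s = a * T s" for s
    unfolding T by (rule DERIV_imp_deriv) (auto intro!: derivative_eq_intros)
  have F: "smooth_on (img c) (f \<circ> chart_inv c)" if "c \<in> A" for c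
    by (rule smooth_h[OF f that])
  have smooth_exp: "smooth_on (img c) (\<lambda>x. exp (b * (f \<circ> chart_inv c) x))" if "c \<in> A" for c b
    using that by (intro smooth_on_exp smooth_on_mult smooth_on_const F open_img)
  have smooth_\<tau>: "smooth_function A \<tau>"
    using smooth_exp[of _ a] by (simp add: smooth_function_def \<tau> o_def)
  have smooth_scale: "smooth_function A (\<lambda>p. 1 / (\<tau> p)\<^sup>2)"
    unfolding scale using smooth_exp[of _ "2 * - a"] by (simp add: smooth_function_def o_def mult.assoc)
  let ?L = "\<lambda>c. coord_metric.laplacian_coord (G c) (f \<circ> chart_inv c)"
  let ?P = "\<lambda>c. coord_metric.gradient_sq (G c) (f \<circ> chart_inv c)"
  \<comment> \<open>The left side mentions no chart, so this both evaluates \<open>lamhat\<close> in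
    any chart around \<open>p\<close> and matches the conformal factor term of
    \<open>soliton_conformal\<close>.\<close>
  have \<beta>\<delta>: "\<beta> p + \<delta> p = a * ?L c (snd c p) - a * ?P c (snd c p)" if c: "c \<in> A" "p \<in> fst c" for c p
  proof -
    interpret coord_metric "img c" "G c" by (rule coord_metric[OF c(1)])
    have x: "snd c p \<in> img c" using c by simp
    have \<tau>c: "\<tau> \<circ> chart_inv c = (\<lambda>x. exp (a * (f \<circ> chart_inv c) x))" by (simp add: \<tau> o_def)
    have \<tau>p: "exp (a * (f \<circ> chart_inv c) (snd c p)) = \<tau> p" by (simp add: \<tau> inv_left[OF c])
    have cancel: "inverse t * (t * (a * L + a\<^sup>2 * P)) - (n - 1) * inverse (t\<^sup>2) * (a\<^sup>2 * t\<^sup>2 * P)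
        + inverse t * (a * t) * P = a * L + a\<^sup>2 * P - (n - 1) * (a\<^sup>2 * P) + a * P"
      if "t \<noteq> 0" for t L P
      using that by (simp add: field_simps)
    note \<tau>_nonzero[of p]
    moreover have "laplacian A g \<tau> p = \<tau> p * (a * ?L c (snd c p) + a\<^sup>2 * ?P c (snd c p))"
      unfolding laplacian_eq[OF smooth_\<tau> c] \<tau>c laplacian_coord_exp[OF F[OF c(1)] x] \<tau>p ..
    moreover have "(metric_norm A g (gradient g \<tau>) p)\<^sup>2 = a\<^sup>2 * (\<tau> p)\<^sup>2 * ?P c (snd c p)"
      unfolding metric_norm_gradient[OF smooth_\<tau> c] \<tau>c gradient_sq_exp[OF F[OF c(1)] x] \<tau>p ..
    moreover have "deriv T (f p) = a * \<tau> p" by (simp add: dT assms(6))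
    ultimately have "\<beta> p + \<delta> p = a * ?L c (snd c p) + a\<^sup>2 * ?P c (snd c p)
        - (n - 1) * (a\<^sup>2 * ?P c (snd c p)) + a * ?P c (snd c p)"
      unfolding assms(9,10) metric_norm_gradient[OF f c] by (simp only: cancel not_False_eq_True)
    \<comment> \<open>The factor (n - 2) a is isolated in order to be replaced by 2.\<close>
    also have "\<dots> = a * ?L c (snd c p) - ((real CARD('n) - 2) * a) * (a * ?P c (snd c p))
        + a * ?P c (snd c p)"
      unfolding assms(2) by (simp add: algebra_simps power2_eq_square)
    finally show ?thesis unfolding a by simp
  qed
  have "almost_soliton_with A ghat fhat lamhat"
    unfolding almost_soliton_with_def
  proof (intro conjI ballI)
    show "riemannian_metric A ghat"
      unfolding assms(7) by (rule riemannian_metric_scaleR[OF _ smooth_scale]) (simp add: \<tau>)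
    show "smooth_function A fhat"
      using smooth_on_minus[OF open_img F] unfolding assms(8) smooth_function_def by (simp add: o_def)
    show "smooth_function A lamhat"
      unfolding smooth_function_def
    proof
      fix c
      assume c: "c \<in> A"
      interpret coord_metric "img c" "G c" by (rule coord_metric[OF c])
      \<comment> \<open>Smoothness is shown for the coordinate expression and then transferred to
        \<open>lamhat\<close>, which agrees with it on the open image of the chart.\<close>
      have "smooth_on (img c) (\<lambda>x. exp ((2 * a) * (f \<circ> chart_inv c) x) *
          ((lam \<circ> chart_inv c) x + (a * ?L c x - a * ?P c x)))"
        by (intro smooth_intros smooth_exp smooth_laplacian_coord smooth_gradient_sq F smooth_h[OF lam] c)
      moreover have "(lamhat \<circ> chart_inv c) x = exp ((2 * a) * (f \<circ> chart_inv c) x) *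
          ((lam \<circ> chart_inv c) x + (a * ?L c x - a * ?P c x))" if x: "x \<in> img c" for x
      proof -
        obtain p where p: "p \<in> fst c" "x = snd c p" using x by blast
        have "(\<tau> p)\<^sup>2 = exp ((2 * a) * f p)"
          by (simp only: \<tau> mult.assoc exp_double)
        then show ?thesis
          unfolding p(2) o_apply inv_left[OF c p(1)] assms(11)
          using \<beta>\<delta>[OF c p(1)] by (simp only: add.assoc o_def)
      qed
      ultimately show "smooth_on (img c) (lamhat \<circ> chart_inv c)"
        by (rule smooth_on_cong[OF open_img[OF c], THEN iffD2, rotated])
    qed
  next
    fix c p
    assume c: "c \<in> A" "p \<in> fst c"
    interpret coord_metric "img c" "G c" by (rule coord_metric[OF c(1)])
    have x: "snd c p \<in> img c" using c by simp
    have gh: "ghat c \<circ> chart_inv c = (\<lambda>y. exp (2 * (- a * (f \<circ> chart_inv c) y)) *\<^sub>R G c y)"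
      by (rule ext) (simp only: assms(7) scale o_apply)
    have fh: "fhat \<circ> chart_inv c = (\<lambda>y. - (f \<circ> chart_inv c) y)"
      by (rule ext) (simp only: assms(8) o_apply)
    have Gp: "G c (snd c p) = g c p" by (simp only: o_apply inv_left[OF c])
    have "ricci ghat c p + hessian ghat fhat c p =
        ricci g c p + hessian g f c p + (a * ?L c (snd c p) - a * ?P c (snd c p)) *\<^sub>R g c p"
      unfolding ricci_def hessian_def fh soliton_conformal[OF F[OF c(1)] x a gh] Gp by (rule refl)
    also have "\<dots> = (lam p + \<beta> p + \<delta> p) *\<^sub>R g c p"
      unfolding soliton[OF c] \<beta>\<delta>[OF c, symmetric] by (simp add: scaleR_add_left)
    also have "\<dots> = lamhat p *\<^sub>R ghat c p"
      unfolding assms(7,11) using \<tau>_nonzero[of p] by simp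
    finally show "ricci ghat c p + hessian ghat fhat c p = lamhat p *\<^sub>R ghat c p" .
  qed
  then show ?thesis unfolding almost_soliton_pair_def by (intro conjI exI)
qed

end
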